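(* Let $0<l<\infty$, $\theta\in\mathbb{C}$ with $|\theta|=1$, $\theta\neq-1$, and let $L_\theta$ be the operator defined below. Let $\lambda\in\mathbb{C}\setminus\{0\}$ with $\Delta_\theta(\lambda)\neq0$. Then $\lambda^3$ belongs to the resolvent set of $L_\theta$, and for every $f\in L^2(0,l)$ and $x\in[0,l]$, $$\big((L_\theta-\lambda^3I)^{-1}f\big)(x)=\frac{i}{\lambda^4\Delta_\theta(\lambda)}\Bigg\{\int_0^x s_2(i\lambda(x-t))\,s_2(i\lambda l)f(t)\,dt-\theta\int_x^l s_2(i\lambda(x-t))\,s_2(-i\lambda l)f(t)\,dt$$ $$\qquad+\int_0^l\Big[\theta\,s_2(i\lambda(x-l))\,s_2(-i\lambda t)-s_2(i\lambda x)\,s_2(i\lambda(l-t))\Big]f(t)\,dt\Bigg\}.$$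
   Context: Let $\zeta_m=e^{2\pi i m/3}$, $m=0,1,2$, and let $s_k(z)=\frac13\sum_{m=0}^{2}\zeta_m^{-k}e^{z\zeta_m}$, $k=0,1,2$, be the $3$-hyperbolic functions. For $|\theta|=1$ and $l>0$, the characteristic function is $\Delta_\theta(\lambda)=\lambda^{-2}\big[s_2(i\lambda l)+\theta\,s_2(-i\lambda l)\big]$. $L_\theta$ is the operator in $L^2(0,l)$ given by $L_\theta y=(-i)^3y'''=iy'''$ on the domain of all $y$ with $y,y',y''$ absolutely continuous on $[0,l]$, $y'''\in L^2(0,l)$, and $y(0)=0$, $y'(0)=\theta y'(l)$, $y(l)=0$. *)

theory Defs
  imports "HOL-Analysis.Analysis"
begin

definition zeta3 :: "nat \<Rightarrow> complex" where
  "zeta3 m = exp (2 * pi * \<i> * of_nat m / 3)"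

definition s3 :: "nat \<Rightarrow> complex \<Rightarrow> complex" where
  "s3 k z = (1/3) * (\<Sum>m<3. inverse (zeta3 m ^ k) * exp (z * zeta3 m))"

definition Delta :: "real \<Rightarrow> complex \<Rightarrow> complex \<Rightarrow> complex" where
  "Delta l \<theta> lam = (s3 2 (\<i> * lam * of_real l) + \<theta> * s3 2 (- \<i> * lam * of_real l)) / lam^2"

definition L2 :: "real \<Rightarrow> (real \<Rightarrow> complex) \<Rightarrow> bool" where
  "L2 l f \<longleftrightarrow> set_borel_measurable lborel {0..l} f \<and>
                set_integrable lborel {0..l} (\<lambda>t. (cmod (f t))^2)"

definition L2norm :: "real \<Rightarrow> (real \<Rightarrow> complex) \<Rightarrow> real" where
  "L2norm l f = sqrt (set_lebesgue_integral lborel {0..l} (\<lambda>t. (cmod (f t))^2))"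

definition abs_cont_on :: "real \<Rightarrow> real \<Rightarrow> (real \<Rightarrow> complex) \<Rightarrow> bool" where
  "abs_cont_on a b g \<longleftrightarrow>
    (\<forall>\<epsilon>>0. \<exists>\<delta>>0. \<forall>(n::nat) (u::nat\<Rightarrow>real) (v::nat\<Rightarrow>real).
       (\<forall>i<n. a \<le> u i \<and> u i \<le> v i \<and> v i \<le> b) \<and>
       (\<forall>i<n. \<forall>j<n. i \<noteq> j \<longrightarrow> v i \<le> u j \<or> v j \<le> u i) \<and>
       (\<Sum>i<n. v i - u i) < \<delta>
       \<longrightarrow> (\<Sum>i<n. cmod (g (v i) - g (u i))) < \<epsilon>)"

text \<open>Ldom l theta y w: y lies in the domain of L_theta and w is (a version of) y'''.
  y1, y2 are y', y''; derivatives of absolutely continuous functions are taken a.e.\<close>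
definition Ldom :: "real \<Rightarrow> complex \<Rightarrow> (real \<Rightarrow> complex) \<Rightarrow> (real \<Rightarrow> complex) \<Rightarrow> bool" where
  "Ldom l \<theta> y w \<longleftrightarrow>
    (\<exists>y1 y2. abs_cont_on 0 l y \<and> abs_cont_on 0 l y1 \<and> abs_cont_on 0 l y2 \<and>
      (AE t in lborel. t \<in> {0..l} \<longrightarrow> (y has_vector_derivative y1 t) (at t)) \<and>
      (AE t in lborel. t \<in> {0..l} \<longrightarrow> (y1 has_vector_derivative y2 t) (at t)) \<and>
      (AE t in lborel. t \<in> {0..l} \<longrightarrow> (y2 has_vector_derivative w t) (at t)) \<and>
      L2 l w \<and>
      y 0 = 0 \<and> y1 0 = \<theta> * y1 l \<and> y l = 0)"

text \<open>(L_theta - mu I) y = f in L^2(0,l), where L_theta y = (-i)^3 y''' = i y'''.\<close>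
definition Lres_eq :: "real \<Rightarrow> complex \<Rightarrow> complex \<Rightarrow> (real \<Rightarrow> complex) \<Rightarrow> (real \<Rightarrow> complex) \<Rightarrow> (real \<Rightarrow> complex) \<Rightarrow> bool" where
  "Lres_eq l \<theta> \<mu> y w f \<longleftrightarrow> Ldom l \<theta> y w \<and>
     (AE t in lborel. t \<in> {0..l} \<longrightarrow> \<i> * w t - \<mu> * y t = f t)"

definition resolvent_set :: "real \<Rightarrow> complex \<Rightarrow> complex set" where
  "resolvent_set l \<theta> = {\<mu>.
     (\<forall>f. L2 l f \<longrightarrow> (\<exists>y w. Lres_eq l \<theta> \<mu> y w f)) \<and>
     (\<forall>y w. Lres_eq l \<theta> \<mu> y w (\<lambda>_. 0) \<longrightarrow> (AE t in lborel. t \<in> {0..l} \<longrightarrow> y t = 0)) \<and>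
     (\<exists>C. \<forall>f y w. L2 l f \<and> Lres_eq l \<theta> \<mu> y w f \<longrightarrow> L2norm l y \<le> C * L2norm l f)}"

end

theory Submission
  imports Defs
begin

text \<open>Put \<open>a = \<i>\<lambda>\<close>, so that \<open>(L\<^sub>\<theta> - \<lambda>\<^sup>3) y = f\<close> reads \<open>y''' = a\<^sup>3 y - \<i> f\<close>. Integrating
  \<open>s\<^sub>2(a(c - t)) f(t)\<close> by parts turns every integral in the resolvent formula into boundary values of
  \<open>y, y', y''\<close>. With the boundary conditions, the terms in \<open>y''\<close> cancel, those in \<open>y'(l)\<close> cancel by an
  addition theorem for \<open>s\<^sub>1, s\<^sub>2\<close>, and \<open>y(x)\<close> remains. So the formula holds for every solution, which
  gives uniqueness and the norm bound. For existence, factoring the polynomial \<open>p\<^sup>3 - a\<^sup>3\<close> over the cube roots of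
  unity gives a particular solution as a combination of solutions of three first-order equations, and
  the boundary conditions become a \<open>2 \<times> 2\<close> system whose determinant is, up to sign, \<open>\<lambda>\<^sup>2 \<Delta>\<^sub>\<theta>(\<lambda>)\<close>, because
  \<open>s\<^sub>1(z)\<^sup>2 - s\<^sub>0(z) s\<^sub>2(z) = s\<^sub>2(-z)\<close>.\<close>

section \<open>Absolutely continuous functions\<close>

text \<open>The index set is arbitrary, so that the pieces of a tagged division can serve as their
  own indices. Shared endpoints and degenerate intervals are allowed, as in
  \<open>abs_cont_on_def\<close>.\<close>

definition nonoverlapping :: "real \<Rightarrow> real \<Rightarrow> 'i set \<Rightarrow> ('i \<Rightarrow> real) \<Rightarrow> ('i \<Rightarrow> real) \<Rightarrow> bool" where
  "nonoverlapping a b I u v \<longleftrightarrow> (\<forall>i\<in>I. a \<le> u i \<and> u i \<le> v i \<and> v i \<le> b) \<and>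
     (\<forall>i\<in>I. \<forall>j\<in>I. i \<noteq> j \<longrightarrow> v i \<le> u j \<or> v j \<le> u i)"

lemma abs_cont_on_iff:
  "abs_cont_on a b G \<longleftrightarrow> (\<forall>e>0. \<exists>d>0. \<forall>n u v. nonoverlapping a b {..<n::nat} u v \<and>
     (\<Sum>i<n. v i - u i) < d \<longrightarrow> (\<Sum>i<n. cmod (G (v i) - G (u i))) < e)"
  unfolding abs_cont_on_def nonoverlapping_def Ball_def lessThan_iff conj_assoc ..

text \<open>An enumeration of \<open>I\<close> carries the family back to
  \<open>{..<card I}\<close>, so one \<open>d\<close> serves all finite index sets. This is needed
  below for indices that are pairs of a tag and an interval.\<close>

lemma abs_cont_on_finite_sum:
  assumes "abs_cont_on a b G" "e > 0"
  shows "\<exists>d>0. \<forall>(I::'i set) u v. finite I \<and> nonoverlapping a b I u v \<and> (\<Sum>i\<in>I. v i - u i) < d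
    \<longrightarrow> (\<Sum>i\<in>I. cmod (G (v i) - G (u i))) < e"
proof -
  obtain d where d: "d > 0" and D: "\<forall>n u v. nonoverlapping a b {..<n::nat} u v \<and>
     (\<Sum>i<n. v i - u i) < d \<longrightarrow> (\<Sum>i<n. cmod (G (v i) - G (u i))) < e"
    using assms unfolding abs_cont_on_iff by blast
  have "(\<Sum>i\<in>I. cmod (G (v i) - G (u i))) < e"
    if I: "finite I" and uv: "nonoverlapping a b I u v" and less: "(\<Sum>i\<in>I. v i - u i) < d"
    for I :: "'i set" and u v
  proof -
    obtain h where h: "bij_betw h {..<card I} I"
      using ex_bij_betw_nat_finite[OF I] by (auto simp: atLeast0LessThan)
    have "nonoverlapping a b {..<card I} (\<lambda>i. u (h i)) (\<lambda>i. v (h i))"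
      using h uv unfolding nonoverlapping_def bij_betw_def inj_on_def by (metis imageI)
    moreover have "(\<Sum>i<card I. v (h i) - u (h i)) < d"
      using less sum.reindex_bij_betw[OF h, of "\<lambda>i. v i - u i"] by simp
    ultimately have "(\<Sum>i<card I. cmod (G (v (h i)) - G (u (h i)))) < e"
      using D by blast
    then show ?thesis
      using sum.reindex_bij_betw[OF h, of "\<lambda>i. cmod (G (v i) - G (u i))"] by simp
  qed
  then show ?thesis using d by blast
qed

lemma abs_cont_on_imp_continuous_on:
  assumes "abs_cont_on a b G"
  shows "continuous_on {a..b} G"
  unfolding continuous_on_iff
proof (intro ballI allI impI)
  fix x e :: real assume x: "x \<in> {a..b}" and "e > 0"
  obtain d where "d > 0" and d: "\<forall>(I::unit set) u v. finite I \<and> nonoverlapping a b I u v \<and>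
      (\<Sum>i\<in>I. v i - u i) < d \<longrightarrow> (\<Sum>i\<in>I. cmod (G (v i) - G (u i))) < e"
    using abs_cont_on_finite_sum[OF assms \<open>e > 0\<close>] by blast
  have "dist (G y) (G x) < e" if y: "y \<in> {a..b}" "dist y x < d" for y
    using d[rule_format, of "{()}" "\<lambda>_. min x y" "\<lambda>_. max x y"] x y
    by (cases "x \<le> y") (auto simp: nonoverlapping_def dist_norm min_def max_def norm_minus_commute)
  then show "\<exists>d>0. \<forall>y\<in>{a..b}. dist y x < d \<longrightarrow> dist (G y) (G x) < e"
    using \<open>d > 0\<close> by blast
qed

text \<open>Common source of the closure properties: sums, products and Lipschitz functions all have
  increments dominated in this way. Each of the two terms receives half of \<open>e\<close>, whence
  the tolerance \<open>e / (2 * M)\<close>.\<close>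

lemma abs_cont_on_increment_bound:
  assumes F: "abs_cont_on a b F" and G: "abs_cont_on a b G"
    and H: "\<And>x y. x \<in> {a..b} \<Longrightarrow> y \<in> {a..b} \<Longrightarrow> cmod (H y - H x) \<le> M * cmod (F y - F x) + M * cmod (G y - G x)"
    and "M > 0"
  shows "abs_cont_on a b H"
  unfolding abs_cont_on_iff
proof (intro allI impI)
  fix e :: real assume "e > 0"
  then have e2: "e / (2 * M) > 0" using \<open>M > 0\<close> by simp
  obtain d1 where d1: "d1 > 0" and D1: "\<forall>n u v. nonoverlapping a b {..<n::nat} u v \<and>
     (\<Sum>i<n. v i - u i) < d1 \<longrightarrow> (\<Sum>i<n. cmod (F (v i) - F (u i))) < e / (2 * M)"
    using F e2 unfolding abs_cont_on_iff by blast
  obtain d2 where d2: "d2 > 0" and D2: "\<forall>n u v. nonoverlapping a b {..<n::nat} u v \<and>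
     (\<Sum>i<n. v i - u i) < d2 \<longrightarrow> (\<Sum>i<n. cmod (G (v i) - G (u i))) < e / (2 * M)"
    using G e2 unfolding abs_cont_on_iff by blast
  have "(\<Sum>i<n. cmod (H (v i) - H (u i))) < e"
    if P: "nonoverlapping a b {..<n::nat} u v" "(\<Sum>i<n. v i - u i) < min d1 d2" for n u v
  proof -
    have "(\<Sum>i<n. cmod (H (v i) - H (u i))) \<le> (\<Sum>i<n. M * cmod (F (v i) - F (u i)) + M * cmod (G (v i) - G (u i)))"
      using P(1) by (intro sum_mono H) (force simp: nonoverlapping_def)+
    also have "\<dots> = M * (\<Sum>i<n. cmod (F (v i) - F (u i))) + M * (\<Sum>i<n. cmod (G (v i) - G (u i)))"
      by (simp add: sum.distrib sum_distrib_left)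
    also have "\<dots> < M * (e / (2 * M)) + M * (e / (2 * M))"
      using P \<open>M > 0\<close> by (intro add_strict_mono mult_strict_left_mono D1[rule_format] D2[rule_format]) auto
    also have "\<dots> = e" using \<open>M > 0\<close> by (simp add: field_simps)
    finally show ?thesis .
  qed
  then show "\<exists>d>0. \<forall>n u v. nonoverlapping a b {..<n::nat} u v \<and> (\<Sum>i<n. v i - u i) < d
      \<longrightarrow> (\<Sum>i<n. cmod (H (v i) - H (u i))) < e"
    using d1 d2 by (intro exI[of _ "min d1 d2"]) auto
qed

lemma abs_cont_on_add:
  assumes "abs_cont_on a b F" "abs_cont_on a b G"
  shows "abs_cont_on a b (\<lambda>x. F x + G x)"
proof (rule abs_cont_on_increment_bound[OF assms])
  show "cmod (F y + G y - (F x + G x)) \<le> 1 * cmod (F y - F x) + 1 * cmod (G y - G x)" for x y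
    using norm_triangle_ineq[of "F y - F x" "G y - G x"] by (simp add: algebra_simps)
qed simp

lemma abs_cont_on_mult:
  assumes F: "abs_cont_on a b F" and G: "abs_cont_on a b G"
  shows "abs_cont_on a b (\<lambda>x. F x * G x)"
proof -
  have "bounded (F ` {a..b} \<union> G ` {a..b})"
    using F G by (intro bounded_Un[THEN iffD2] conjI compact_imp_bounded compact_continuous_image
        abs_cont_on_imp_continuous_on) auto
  then obtain M where M: "M > 0" "\<And>x. x \<in> {a..b} \<Longrightarrow> cmod (F x) \<le> M \<and> cmod (G x) \<le> M"
    unfolding bounded_pos by auto
  show ?thesis
  proof (rule abs_cont_on_increment_bound[OF F G _ M(1)])
    fix x y assume xy: "x \<in> {a..b}" "y \<in> {a..b}"
    have "F y * G y - F x * G x = (F y - F x) * G y + F x * (G y - G x)"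
      by (simp add: algebra_simps)
    then have "cmod (F y * G y - F x * G x) \<le> cmod (F y - F x) * cmod (G y) + cmod (F x) * cmod (G y - G x)"
      by (metis norm_mult norm_triangle_ineq)
    also have "\<dots> \<le> cmod (F y - F x) * M + M * cmod (G y - G x)"
      using M(1) M(2)[OF xy(1)] M(2)[OF xy(2)] by (intro add_mono mult_mono) auto
    finally show "cmod (F y * G y - F x * G x) \<le> M * cmod (F y - F x) + M * cmod (G y - G x)"
      by (simp add: mult.commute)
  qed
qed

lemma abs_cont_on_of_real: "abs_cont_on a b complex_of_real"
  unfolding abs_cont_on_def
proof (intro allI impI)
  fix e :: real assume "e > 0"
  then show "\<exists>\<delta>>0. \<forall>n u v. (\<forall>i<n. a \<le> u i \<and> u i \<le> v i \<and> v i \<le> b) \<and>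
       (\<forall>i<n. \<forall>j<n. i \<noteq> j \<longrightarrow> v i \<le> u j \<or> v j \<le> u i) \<and>
       (\<Sum>i<n. v i - u i) < \<delta> \<longrightarrow> (\<Sum>i<n. cmod (complex_of_real (v i) - complex_of_real (u i))) < e"
    by (intro exI[of _ e]) (auto simp flip: of_real_diff)
qed

lemma abs_cont_on_C1:
  fixes F F' :: "real \<Rightarrow> complex"
  assumes der: "\<And>t. (F has_vector_derivative F' t) (at t)" and cont: "continuous_on UNIV F'"
  shows "abs_cont_on a b F"
proof -
  have "bounded (F' ` {a..b})"
    using cont by (intro compact_imp_bounded compact_continuous_image) (auto intro: continuous_on_subset)
  then obtain M where M: "M > 0" "\<And>x. x \<in> {a..b} \<Longrightarrow> cmod (F' x) \<le> M"
    unfolding bounded_pos by auto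
  show ?thesis
  \<comment> \<open>Both comparison functions are the identity, so a Lipschitz bound suffices; the
    doubled right-hand side is harmless.\<close>
  proof (rule abs_cont_on_increment_bound[OF abs_cont_on_of_real abs_cont_on_of_real _ M(1)])
    fix x y assume xy: "x \<in> {a..b}" "y \<in> {a..b}"
    have "cmod (F y - F x) \<le> M * norm (y - x)"
    proof (rule differentiable_bound[of "{a..b}"])
      show "(F has_derivative (\<lambda>h. h *\<^sub>R F' t)) (at t within {a..b})" for t
        using der[of t] by (auto simp: has_vector_derivative_def intro: has_derivative_at_withinI)
      show "onorm (\<lambda>h. h *\<^sub>R F' t) \<le> M" if "t \<in> {a..b}" for t
        using M(2)[OF that] by (intro onorm_le) (simp add: mult.commute[of _ "cmod (F' t)"] mult_right_mono)
    qed (use xy in auto)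
    moreover have "0 \<le> M * norm (y - x)" using M(1) by simp
    ultimately show "cmod (F y - F x) \<le> M * cmod (complex_of_real y - complex_of_real x) + M * cmod (complex_of_real y - complex_of_real x)"
      by (simp flip: of_real_diff)
  qed
qed

lemma abs_cont_on_subinterval:
  assumes "abs_cont_on a b G" "a \<le> p" "q \<le> b"
  shows "abs_cont_on p q G"
proof -
  have "nonoverlapping a b I u v" if "nonoverlapping p q I u v" for I :: "nat set" and u v
    using that assms(2,3) unfolding nonoverlapping_def by (meson order_trans)
  then show ?thesis using assms(1) unfolding abs_cont_on_iff by meson
qed

lemma abs_cont_on_cmult:
  assumes "abs_cont_on a b G"
  shows "abs_cont_on a b (\<lambda>x. c * G x)"
  by (intro abs_cont_on_mult assms abs_cont_on_C1[of "\<lambda>_. c" "\<lambda>_. 0"]) (auto intro: derivative_intros)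

text \<open>Intervals tagged in the exceptional null set lie in an open set of small measure, so
  absolute continuity bounds their contribution; the others are handled by the straddle estimate.\<close>

lemma abs_cont_on_has_integral:
  fixes F g :: "real \<Rightarrow> complex"
  assumes "a \<le> b" and AC: "abs_cont_on a b F"
    and der: "AE t in lborel. t \<in> {a..b} \<longrightarrow> (F has_vector_derivative g t) (at t)"
  shows "(g has_integral (F b - F a)) {a..b}"
proof -
  obtain N where N0: "N \<in> null_sets lborel"
    and derN: "\<And>t. t \<in> {a..b} \<Longrightarrow> t \<notin> N \<Longrightarrow> (F has_vector_derivative g t) (at t)"
    using der by (elim AE_E3) auto
  have negN: "negligible N"
    using N0 by (simp add: negligible_iff_null_sets null_sets_completionI)
  \<comment> \<open>Clearing \<open>g\<close> on the exceptional set does not affect the integral,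
    and pieces tagged in \<open>N\<close> then contribute increments of \<open>F\<close>
    only.\<close>
  define g' where "g' = (\<lambda>t. if t \<in> N then 0 else g t)"
  have "(g' has_integral (F b - F a)) {a..b}"
    unfolding has_integral_real
  proof (intro allI impI)
    fix e :: real assume e: "e > 0"
    \<comment> \<open>The summand 1 avoids division by zero when \<open>a = b\<close> and makes the
      inequality with \<open>e / 2\<close> strict.\<close>
    define e' where "e' = e / (2 * (b - a + 1))"
    have e': "e' > 0" "e' * (b - a) < e / 2"
      using e \<open>a \<le> b\<close> by (auto simp: e'_def field_simps)
    obtain d where "d > 0" and d: "\<forall>(I::(real \<times> real set) set) u v. finite I \<and> nonoverlapping a b I u v \<and>
        (\<Sum>i\<in>I. v i - u i) < d \<longrightarrow> (\<Sum>i\<in>I. cmod (F (v i) - F (u i))) < e / 2"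
      using abs_cont_on_finite_sum[OF AC half_gt_zero[OF e]] by blast
    obtain G where G: "open G" "N \<subseteq> G" "G - N \<in> lmeasurable" "emeasure lebesgue (G - N) < ennreal d"
      using sets_lebesgue_outer_open[of N d] \<open>d > 0\<close> negN negligible_imp_sets by blast
    have Gm: "G \<in> lmeasurable" "measure lebesgue G < d"
    proof -
      have NN: "N \<in> null_sets lebesgue" using negN by (simp add: negligible_iff_null_sets)
      have "emeasure lebesgue G = emeasure lebesgue (G - N)"
        using NN G(1) by (simp add: emeasure_Diff_null_set)
      then have em: "emeasure lebesgue G < ennreal d" using G by simp
      then show "G \<in> lmeasurable"
        using G(1) by (intro fmeasurableI) (auto intro: less_trans)
      then show "measure lebesgue G < d"
        using em \<open>d > 0\<close> by (simp add: emeasure_eq_measure2 ennreal_less_iff)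
    qed
    \<comment> \<open>One radius for both kinds of tags: inside \<open>G\<close> for tags in
      \<open>N\<close>, and small enough for the first-order approximation of \<open>F\<close> at
      all other tags in the interval.\<close>
    have "\<exists>r>0. (x \<in> N \<longrightarrow> ball x r \<subseteq> G) \<and>
        (x \<in> {a..b} - N \<longrightarrow> (\<forall>y. \<bar>y - x\<bar> < r \<longrightarrow> cmod (F y - F x - (y - x) *\<^sub>R g x) \<le> e' * \<bar>y - x\<bar>))" for x
    proof (cases "x \<in> N")
      case True
      then show ?thesis using G(1,2) by (meson DiffE openE subset_iff)
    next
      case False
      show ?thesis
      proof (cases "x \<in> {a..b}")
        case True
        with False derN[of x] have "(F has_derivative (\<lambda>h. h *\<^sub>R g x)) (at x)"
          by (simp add: has_vector_derivative_def)
        then obtain r where "r > 0" "\<forall>y. norm (y - x) < r \<longrightarrow> norm (F y - F x - (y - x) *\<^sub>R g x) \<le> e' * norm (y - x)"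
          using e'(1) unfolding has_derivative_at_alt by blast
        then show ?thesis using False by auto
      qed (use False in \<open>auto intro: exI[of _ 1]\<close>)
    qed
    then obtain r where r: "\<And>x. r x > 0" "\<And>x. x \<in> N \<Longrightarrow> ball x (r x) \<subseteq> G"
      "\<And>x y. \<lbrakk>x \<in> {a..b}; x \<notin> N; \<bar>y - x\<bar> < r x\<rbrakk> \<Longrightarrow> cmod (F y - F x - (y - x) *\<^sub>R g x) \<le> e' * \<bar>y - x\<bar>"
      by (metis DiffI)
    show "\<exists>\<gamma>. gauge \<gamma> \<and> (\<forall>\<D>. \<D> tagged_division_of {a..b} \<and> \<gamma> fine \<D> \<longrightarrow>
        norm ((\<Sum>(x, k)\<in>\<D>. measure lborel k *\<^sub>R g' x) - (F b - F a)) < e)"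
    proof (intro exI[of _ "\<lambda>x. ball x (r x)"] conjI allI impI)
      show "gauge (\<lambda>x. ball x (r x))" using r(1) by (intro gauge_ball_dependent) auto
      fix p assume "p tagged_division_of {a..b} \<and> (\<lambda>x. ball x (r x)) fine p"
      then have p: "p tagged_division_of {a..b}" and fine: "\<And>x k. (x,k) \<in> p \<Longrightarrow> k \<subseteq> ball x (r x)"
        by (auto simp: fine_def)
      have finp: "finite p" using p by blast
      have pk: "\<exists>u v. k = {u..v} \<and> u \<le> x \<and> x \<le> v \<and> a \<le> u \<and> v \<le> b \<and> Inf k = u \<and> Sup k = v \<and> measure lborel k = v - u"
        if xk: "(x,k) \<in> p" for x k
      proof -
        obtain u v where k: "k = {u..v}"
          using tagged_division_ofD(4)[OF p xk] by (auto simp: box_real)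
        have "x \<in> k" "k \<subseteq> {a..b}"
          using tagged_division_ofD(2,3)[OF p xk] by auto
        then show ?thesis using k by (intro exI[of _ u] exI[of _ v]) auto
      qed
      define D where "D = (\<lambda>(x,k). measure lborel k *\<^sub>R g' x - (F (Sup k) - F (Inf k)))"
      define p1 where "p1 = {(x,k)\<in>p. x \<notin> N}"
      \<comment> \<open>Degenerate pieces tagged in \<open>N\<close> contribute nothing and are
        dropped. The remaining ones have nonempty interiors, which is what turns disjointness of
        interiors into an ordering of the intervals.\<close>
      define p2 where "p2 = {(x,k)\<in>p. x \<in> N \<and> measure lborel k \<noteq> 0}"
      have p12: "p1 \<subseteq> p" "p2 \<subseteq> p" "p1 \<inter> p2 = {}" by (auto simp: p1_def p2_def)
      then have fin12: "finite p1" "finite p2" using finite_subset[OF _ finp] by auto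
      have "(\<Sum>(x, k)\<in>p. measure lborel k *\<^sub>R g' x) - (F b - F a) = sum D p"
        unfolding additive_tagged_division_1[OF \<open>a \<le> b\<close> p, of F, symmetric] D_def
        by (simp add: sum_subtractf case_prod_unfold)
      also have "\<dots> = sum D (p1 \<union> p2)"
      proof (rule sum.mono_neutral_right[OF finp])
        show "\<forall>i\<in>p - (p1 \<union> p2). D i = 0"
          using pk by (fastforce simp: D_def p1_def p2_def)
      qed (use p12 in auto)
      also have "\<dots> = sum D p1 + sum D p2"
        using fin12 p12 by (intro sum.union_disjoint)
      finally have eq: "(\<Sum>(x, k)\<in>p. measure lborel k *\<^sub>R g' x) - (F b - F a) = sum D p1 + sum D p2" .
      have "norm (sum D p1) \<le> (\<Sum>(x,k)\<in>p1. e' * measure lborel k)"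
      proof (rule sum_norm_le, clarify)
        fix x k assume xk: "(x,k) \<in> p1"
        then have xkp: "(x,k) \<in> p" and "x \<notin> N" by (auto simp: p1_def)
        obtain u v where k: "k = {u..v}" "u \<le> x" "x \<le> v" "a \<le> u" "v \<le> b" "Inf k = u" "Sup k = v" "measure lborel k = v - u"
          using pk[OF xkp] by blast
        have "{u..v} \<subseteq> ball x (r x)" using fine[OF xkp] k by simp
        moreover have "u \<in> {u..v}" "v \<in> {u..v}" using k(2,3) by auto
        ultimately have "u \<in> ball x (r x)" "v \<in> ball x (r x)" by blast+
        then have "\<bar>u - x\<bar> < r x" "\<bar>v - x\<bar> < r x"
          by (auto simp: dist_real_def abs_minus_commute)
        then have "cmod (F u - F x - (u - x) *\<^sub>R g x) \<le> e' * (x - u)"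
            "cmod (F v - F x - (v - x) *\<^sub>R g x) \<le> e' * (v - x)"
          using r(3)[of x u] r(3)[of x v] \<open>x \<notin> N\<close> k by auto
        \<comment> \<open>Straddling: the tag lies between the endpoints, so the errors at
          \<open>u\<close> and \<open>v\<close> add up to at most
          \<open>e' * (v - u)\<close>.\<close>
        moreover have "D (x,k) = (F u - F x - (u - x) *\<^sub>R g x) - (F v - F x - (v - x) *\<^sub>R g x)"
          using k \<open>x \<notin> N\<close> by (simp add: D_def g'_def algebra_simps)
        ultimately have "norm (D (x,k)) \<le> e' * (x - u) + e' * (v - x)"
          by (metis norm_triangle_ineq4 add_mono order_trans)
        then show "norm (D (x,k)) \<le> e' * measure lborel k"
          using k by (simp add: algebra_simps)
      qed
      also have "\<dots> \<le> (\<Sum>(x,k)\<in>p. e' * measure lborel k)"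
        using finp p12(1) e'(1) by (intro sum_mono2) auto
      also have "\<dots> = e' * (b - a)"
        using additive_content_tagged_division[of p a b] p \<open>a \<le> b\<close>
        by (simp add: sum_distrib_left[symmetric] case_prod_unfold box_real)
      finally have b1: "norm (sum D p1) < e / 2" using e'(2) by simp
      have op: "(x,k) \<in> p2 \<Longrightarrow> Inf k < Sup k \<and> k = {Inf k..Sup k} \<and> interior k = {Inf k<..<Sup k}
          \<and> {Inf k<..<Sup k} \<subseteq> G \<and> a \<le> Inf k \<and> Sup k \<le> b" for x k
        using pk[of x k] fine[of x k] r(2)[of x] by (fastforce simp: p2_def interior_atLeastAtMost_real)
      have dj: "{Inf (snd i)<..<Sup (snd i)} \<inter> {Inf (snd j)<..<Sup (snd j)} = {}"
        if "i \<in> p2" "j \<in> p2" "i \<noteq> j" for i j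
        using tagged_division_ofD(5)[OF p, of "fst i" "snd i" "fst j" "snd j"] that p12(2)
          op[of "fst i" "snd i"] op[of "fst j" "snd j"] by (auto simp: prod_eq_iff)
      have emeasure_fin: "emeasure lebesgue {Inf (snd i)<..<Sup (snd i)} \<noteq> \<infinity>" if "i \<in> p2" for i
        using op[of "fst i" "snd i"] that by (simp add: less_imp_le)
      \<comment> \<open>The interiors are disjoint subsets of \<open>G\<close>, so the total length
        is at most the measure of \<open>G\<close>, hence less than \<open>d\<close>.\<close>
      have "(\<Sum>i\<in>p2. Sup (snd i) - Inf (snd i)) = (\<Sum>i\<in>p2. measure lebesgue {Inf (snd i)<..<Sup (snd i)})"
        using op by (intro sum.cong) (auto simp: less_imp_le)
      also have "\<dots> = measure lebesgue (\<Union>i\<in>p2. {Inf (snd i)<..<Sup (snd i)})"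
      proof (rule measure_finite_Union[symmetric])
        show "disjoint_family_on (\<lambda>i. {Inf (snd i)<..<Sup (snd i)}) p2"
          using dj unfolding disjoint_family_on_def by blast
      qed (use fin12 emeasure_fin in auto)
      also have "\<dots> \<le> measure lebesgue G"
      proof (rule measure_mono_fmeasurable)
        show "(\<Union>i\<in>p2. {Inf (snd i)<..<Sup (snd i)}) \<subseteq> G"
          using op by (intro UN_least) (metis prod.collapse)
        show "(\<Union>i\<in>p2. {Inf (snd i)<..<Sup (snd i)}) \<in> sets lebesgue"
          using fin12 by (intro sets.finite_UN) auto
      qed (rule Gm)
      finally have less_d: "(\<Sum>i\<in>p2. Sup (snd i) - Inf (snd i)) < d" using Gm by simp
      have "Sup (snd i) \<le> Inf (snd j) \<or> Sup (snd j) \<le> Inf (snd i)"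
        if ij: "i \<in> p2" "j \<in> p2" "i \<noteq> j" for i j
      proof (rule ccontr)
        assume "\<not> ?thesis"
        then have "max (Inf (snd i)) (Inf (snd j)) < min (Sup (snd i)) (Sup (snd j))"
          using op[of "fst i" "snd i"] op[of "fst j" "snd j"] ij by auto
        then obtain t where "max (Inf (snd i)) (Inf (snd j)) < t" "t < min (Sup (snd i)) (Sup (snd j))"
          using dense by blast
        then show False using dj[OF ij] by auto
      qed
      then have "nonoverlapping a b p2 (\<lambda>i. Inf (snd i)) (\<lambda>i. Sup (snd i))"
        using op unfolding nonoverlapping_def by (auto simp: less_imp_le)
      then have "(\<Sum>i\<in>p2. cmod (F (Sup (snd i)) - F (Inf (snd i)))) < e / 2"
        using d fin12 less_d by blast
      moreover have "norm (sum D p2) \<le> (\<Sum>i\<in>p2. cmod (F (Sup (snd i)) - F (Inf (snd i))))"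
        by (rule sum_norm_le) (auto simp: D_def p2_def g'_def norm_minus_commute)
      ultimately show "norm ((\<Sum>(x, k)\<in>p. measure lborel k *\<^sub>R g' x) - (F b - F a)) < e"
        unfolding eq using b1 norm_triangle_ineq[of "sum D p1" "sum D p2"] by linarith
    qed
  qed
  then show ?thesis
    by (rule has_integral_spike[OF negN, rotated]) (auto simp: g'_def)
qed

section \<open>Indefinite integrals: derivative almost everywhere and absolute continuity\<close>

lemma negligible_AE: "negligible N \<Longrightarrow> AE x in lborel. x \<notin> N"
  using AE_not_in[of N "completion lborel"] AE_completion_iff[of "\<lambda>x. x \<notin> N" lborel]
  by (simp add: negligible_iff_null_sets)

text \<open>Lebesgue differentiation. \<open>integrable_ccontinuous_explicit\<close> controls
  averages over intervals to the right of a point; applied to the reflected function it controls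
  those to the left, and the reflection of its null set is again null.\<close>

lemma integral_has_vector_derivative_AE:
  fixes g :: "real \<Rightarrow> complex"
  assumes g: "\<And>p q. g integrable_on {p..q}"
  shows "AE x in lborel. a < x \<longrightarrow> ((\<lambda>x. integral {a..x} g) has_vector_derivative g x) (at x)"
proof -
  have g': "(\<lambda>x. g (- x)) integrable_on {p..q}" for p q
    using g[of "- q" "- p"] Henstock_Kurzweil_Integration.integrable_reflect_real[of g "- p" "- q"] by simp
  obtain N1 where N1: "negligible N1"
    "\<And>x e. \<lbrakk>x \<notin> N1; 0 < e\<rbrakk> \<Longrightarrow> \<exists>d>0. \<forall>h. 0 < h \<and> h < d \<longrightarrow>
       norm (integral (cbox x (x + h *\<^sub>R One)) g /\<^sub>R h ^ DIM(real) - g x) < e"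
    using integrable_ccontinuous_explicit[of g] g by (auto simp: box_real)
  obtain N2 where N2: "negligible N2"
    "\<And>x e. \<lbrakk>x \<notin> N2; 0 < e\<rbrakk> \<Longrightarrow> \<exists>d>0. \<forall>h. 0 < h \<and> h < d \<longrightarrow>
       norm (integral (cbox x (x + h *\<^sub>R One)) (\<lambda>x. g (- x)) /\<^sub>R h ^ DIM(real) - g (- x)) < e"
    using integrable_ccontinuous_explicit[of "\<lambda>x. g (- x)"] g' by (auto simp: box_real)
  \<comment> \<open>Rewrites convergence of averages as the increment estimate in the definition of
    the derivative.\<close>
  have scale: "norm (I /\<^sub>R h - v) < e \<longleftrightarrow> norm (I - h *\<^sub>R v) < e * h" if "h > 0" for I v :: complex and h e :: real
  proof -
    have "I - h *\<^sub>R v = h *\<^sub>R (I /\<^sub>R h - v)" using that by (simp add: scaleR_right_diff_distrib)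
    then have "norm (I - h *\<^sub>R v) = h * norm (I /\<^sub>R h - v)" using that by (metis norm_scaleR abs_of_pos)
    then show ?thesis using that by (simp add: mult.commute)
  qed
  have "negligible (uminus ` N2)"
    using N2(1) by (intro negligible_differentiable_image_negligible) (auto intro!: derivative_intros)
  then have "AE x in lborel. x \<notin> uminus ` N2" by (rule negligible_AE)
  with negligible_AE[OF N1(1)] show ?thesis
  proof eventually_elim
    case (elim x)
    have x: "x \<notin> N1" "- x \<notin> N2" using elim by (auto simp: image_iff)
    show ?case
    proof
      assume "a < x"
      show "((\<lambda>x. integral {a..x} g) has_vector_derivative g x) (at x)"
        unfolding has_vector_derivative_def has_derivative_at_alt
      proof (intro conjI allI impI)
        show "bounded_linear (\<lambda>h. h *\<^sub>R g x)" by (rule bounded_linear_scaleR_left)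
        fix e :: real assume e: "e > 0"
        obtain d1 where "d1 > 0" and d1: "\<And>h. 0 < h \<Longrightarrow> h < d1 \<Longrightarrow> norm (integral {x..x + h} g - h *\<^sub>R g x) < e * h"
          using N1(2)[OF x(1) e] scale by (auto simp: box_real)
        obtain d2 where "d2 > 0" and d2: "\<And>h. 0 < h \<Longrightarrow> h < d2 \<Longrightarrow>
            norm (integral {- x..- x + h} (\<lambda>x. g (- x)) - h *\<^sub>R g x) < e * h"
          using N2(2)[OF x(2) e] scale by (auto simp: box_real)
        have "norm (integral {a..y} g - integral {a..x} g - (y - x) *\<^sub>R g x) \<le> e * norm (y - x)"
          \<comment> \<open>The bound \<open>x - a\<close> keeps \<open>y\<close> to the right of
            \<open>a\<close>, where integrals from \<open>a\<close> can be split.\<close>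
          if y: "norm (y - x) < min (min d1 d2) (x - a)" for y
        proof (cases x y rule: linorder_cases)
          case less
          have "integral {a..y} g - integral {a..x} g = integral {x..x + (y - x)} g"
            using Henstock_Kurzweil_Integration.integral_combine[of a x y g] g less \<open>a < x\<close> by (simp add: algebra_simps)
          then show ?thesis using d1[of "y - x"] less y by simp
        next
          case greater
          have "integral {- x..- x + (x - y)} (\<lambda>x. g (- x)) = integral {y..x} g"
            using Henstock_Kurzweil_Integration.integral_reflect_real[of x y g] by simp
          moreover have "integral {a..x} g = integral {a..y} g + integral {y..x} g"
            using Henstock_Kurzweil_Integration.integral_combine[of a y x g] g greater y by simp
          ultimately have "integral {a..y} g - integral {a..x} g - (y - x) *\<^sub>R g x =
              - (integral {- x..- x + (x - y)} (\<lambda>x. g (- x)) - (x - y) *\<^sub>R g x)"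
            by (simp add: algebra_simps)
          then show ?thesis using d2[of "x - y"] greater y by (simp only: norm_minus_cancel) simp
        qed simp
        then show "\<exists>d>0. \<forall>y. norm (y - x) < d \<longrightarrow>
            norm (integral {a..y} g - integral {a..x} g - (y - x) *\<^sub>R g x) \<le> e * norm (y - x)"
          using \<open>d1 > 0\<close> \<open>d2 > 0\<close> \<open>a < x\<close> by (intro exI[of _ "min (min d1 d2) (x - a)"]) auto
      qed
    qed
  qed
qed

text \<open>The open intervals are pairwise disjoint even when the closed ones touch, so the
  restrictions of the nonnegative integrand to them add up to at most the integrand pointwise.
  Passing to open intervals leaves the integrals unchanged.\<close>

lemma sum_integral_nonoverlapping_le:
  fixes \<phi> :: "real \<Rightarrow> real"
  assumes int: "\<phi> integrable_on {a..b}" and nn: "\<And>t. \<phi> t \<ge> 0"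
    and I: "finite I" and uv: "nonoverlapping a b I u v"
  shows "(\<Sum>i\<in>I. integral {u i..v i} \<phi>) \<le> integral {a..b} \<phi>"
proof -
  have sub: "{u i<..<v i} \<subseteq> {a..b}" "{u i..v i} \<subseteq> {a..b}" if "i \<in> I" for i
    using uv that unfolding nonoverlapping_def by force+
  have restr: "(\<lambda>t. if t \<in> {u i<..<v i} then \<phi> t else 0) integrable_on {a..b}"
      "integral {a..b} (\<lambda>t. if t \<in> {u i<..<v i} then \<phi> t else 0) = integral {u i..v i} \<phi>" if "i \<in> I" for i
  proof -
    have *: "{u i<..<v i} \<inter> {a..b} = {u i<..<v i}" using sub[OF that] by blast
    show "(\<lambda>t. if t \<in> {u i<..<v i} then \<phi> t else 0) integrable_on {a..b}"
      unfolding Henstock_Kurzweil_Integration.integrable_restrict_Int * integrable_on_open_interval_real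
      using integrable_on_subinterval[OF int sub(2)[OF that]] .
    show "integral {a..b} (\<lambda>t. if t \<in> {u i<..<v i} then \<phi> t else 0) = integral {u i..v i} \<phi>"
      unfolding Henstock_Kurzweil_Integration.integral_restrict_Int * integral_open_interval_real ..
  qed
  have "(\<Sum>i\<in>I. integral {u i..v i} \<phi>) = integral {a..b} (\<lambda>t. \<Sum>i\<in>I. if t \<in> {u i<..<v i} then \<phi> t else 0)"
    using I restr by (simp only: Henstock_Kurzweil_Integration.integral_sum) simp
  also have "\<dots> \<le> integral {a..b} \<phi>"
  proof (rule integral_le)
    show "(\<lambda>t. \<Sum>i\<in>I. if t \<in> {u i<..<v i} then \<phi> t else 0) integrable_on {a..b}"
      using I restr by (intro integrable_sum)
    fix t
    show "(\<Sum>i\<in>I. if t \<in> {u i<..<v i} then \<phi> t else 0) \<le> \<phi> t"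
    proof (cases "\<exists>i\<in>I. t \<in> {u i<..<v i}")
      case True
      then obtain i where i: "i \<in> I" "t \<in> {u i<..<v i}" by blast
      have "t \<notin> {u j<..<v j}" if "j \<in> I" "j \<noteq> i" for j
        using uv i that unfolding nonoverlapping_def by force
      then have "(\<Sum>j\<in>I. if t \<in> {u j<..<v j} then \<phi> t else 0) = (\<Sum>j\<in>I. if j = i then \<phi> t else 0)"
        using i by (intro sum.cong) auto
      then show ?thesis using I i by simp
    next
      case False
      then have "(\<Sum>i\<in>I. if t \<in> {u i<..<v i} then \<phi> t else 0) = 0" by (intro sum.neutral) auto
      then show ?thesis using nn[of t] by simp
    qed
  qed (rule int)
  finally show ?thesis .
qed

text \<open>Square integrability gives a quantitative estimate through
  \<open>r \<le> 1 / h + h * r\<^sup>2\<close>: the sum of increments is at most the total length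
  divided by \<open>h\<close>, plus \<open>h * S\<close>.\<close>

lemma abs_cont_on_integral:
  fixes g :: "real \<Rightarrow> complex"
  assumes g: "g integrable_on {a..b}" and g2: "(\<lambda>t. (cmod (g t))\<^sup>2) integrable_on {a..b}"
  shows "abs_cont_on a b (\<lambda>x. integral {a..x} g)"
  unfolding abs_cont_on_iff
proof (intro allI impI)
  fix e :: real assume e: "e > 0"
  define S where "S = integral {a..b} (\<lambda>t. (cmod (g t))\<^sup>2)"
  have "S \<ge> 0" unfolding S_def by (intro Henstock_Kurzweil_Integration.integral_nonneg g2) auto
  \<comment> \<open>This \<open>h\<close> makes the second term smaller than \<open>e / 2\<close>;
    total length below \<open>h * e / 2\<close> then does the same for the first.\<close>
  define h where "h = e / (2 * (S + 1))"
  have h: "h > 0" "h * S < e / 2" using e \<open>S \<ge> 0\<close> by (auto simp: h_def field_simps)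
  have bound: "r \<le> 1 / h + h * r\<^sup>2" if "r \<ge> 0" for r :: real
  proof (cases "r * h \<le> 1")
    case True
    then have "r \<le> 1 / h" using h by (simp add: field_simps)
    moreover have "0 \<le> h * r\<^sup>2" using h by simp
    ultimately show ?thesis by linarith
  next
    case False
    then have "r * 1 \<le> r * (r * h)" using that by (intro mult_left_mono) auto
    moreover have "0 \<le> 1 / h" using h by simp
    ultimately have "r * 1 \<le> 1 / h + r * (r * h)" by linarith
    then show ?thesis by (simp add: power2_eq_square mult_ac)
  qed
  have "(\<Sum>i<n. cmod (integral {a..v i} g - integral {a..u i} g)) < e"
    if P: "nonoverlapping a b {..<n::nat} u v" "(\<Sum>i<n. v i - u i) < h * e / 2" for n u v
  proof -
    have "cmod (integral {a..v i} g - integral {a..u i} g) \<le> (v i - u i) / h + h * integral {u i..v i} (\<lambda>t. (cmod (g t))\<^sup>2)"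
      if "i \<in> {..<n}" for i
    proof -
      have i: "a \<le> u i" "u i \<le> v i" "v i \<le> b" using P(1) that by (auto simp: nonoverlapping_def)
      have gi: "g integrable_on {u i..v i}" "(\<lambda>t. (cmod (g t))\<^sup>2) integrable_on {u i..v i}" "g integrable_on {a..v i}"
        using i by (auto intro: integrable_on_subinterval[OF g] integrable_on_subinterval[OF g2])
      have "integral {a..v i} g - integral {a..u i} g = integral {u i..v i} g"
        using Henstock_Kurzweil_Integration.integral_combine[of a "u i" "v i" g] i gi by (simp add: algebra_simps)
      also have "cmod \<dots> \<le> integral {u i..v i} (\<lambda>t. 1 / h + h * (cmod (g t))\<^sup>2)"
        using bound gi by (intro Henstock_Kurzweil_Integration.integral_norm_bound_integral integrable_add integrable_on_mult_right) auto
      also have "\<dots> = (v i - u i) / h + h * integral {u i..v i} (\<lambda>t. (cmod (g t))\<^sup>2)"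
        using gi i by (subst Henstock_Kurzweil_Integration.integral_add) (auto intro!: integrable_on_mult_right)
      finally show ?thesis .
    qed
    then have "(\<Sum>i<n. cmod (integral {a..v i} g - integral {a..u i} g)) \<le>
        (\<Sum>i<n. (v i - u i) / h + h * integral {u i..v i} (\<lambda>t. (cmod (g t))\<^sup>2))"
      by (rule sum_mono)
    also have "\<dots> = (\<Sum>i<n. v i - u i) / h + h * (\<Sum>i<n. integral {u i..v i} (\<lambda>t. (cmod (g t))\<^sup>2))"
      by (simp add: sum.distrib sum_divide_distrib sum_distrib_left)
    also have "\<dots> \<le> (\<Sum>i<n. v i - u i) / h + h * S"
      unfolding S_def using h P(1) by (intro add_left_mono mult_left_mono sum_integral_nonoverlapping_le g2) auto
    also have "(\<Sum>i<n. v i - u i) / h < e / 2"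
      using P(2) h by (simp add: field_simps)
    finally show ?thesis using h by simp
  qed
  then show "\<exists>d>0. \<forall>n u v. nonoverlapping a b {..<n::nat} u v \<and> (\<Sum>i<n. v i - u i) < d
      \<longrightarrow> (\<Sum>i<n. cmod (integral {a..v i} g - integral {a..u i} g)) < e"
    using h e by (intro exI[of _ "h * e / 2"]) auto
qed

section \<open>Square-integrable functions on a bounded interval\<close>

lemma L2_integrable:
  assumes "L2 l f"
  shows "set_integrable lborel {0..l} f"
proof (rule set_integrable_bound)
  show "set_integrable lborel {0..l} (\<lambda>t. 1 + (cmod (f t))\<^sup>2)"
    using assms borel_integrable_atLeastAtMost'[of 0 l "\<lambda>_. 1::real"]
    unfolding L2_def by (intro set_integral_add(1)) auto
  have "r \<le> 1 + r\<^sup>2" for r :: real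
    using zero_le_power2[of "r - 1/2"] by (simp add: power2_eq_square algebra_simps)
  then show "AE t in lborel. t \<in> {0..l} \<longrightarrow> cmod (f t) \<le> norm (1 + (cmod (f t))\<^sup>2)"
    by (auto simp: abs_of_nonneg)
qed (use assms in \<open>auto simp: L2_def\<close>)

lemma L2_mult_continuous:
  assumes h: "continuous_on {0..l} h" and f: "L2 l f"
  shows "L2 l (\<lambda>t. h t * f t)"
proof -
  have "bounded (h ` {0..l})"
    using h by (intro compact_imp_bounded compact_continuous_image) auto
  then obtain M where M: "\<And>t. t \<in> {0..l} \<Longrightarrow> cmod (h t) \<le> M"
    unfolding bounded_iff by (metis imageI)
  \<comment> \<open>Both factors carry the indicator because measurability of \<open>f\<close> and
    continuity of \<open>h\<close> are known on the interval only.\<close>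
  have "(\<lambda>t. (indicator {0..l} t *\<^sub>R h t) * (indicator {0..l} t *\<^sub>R f t)) \<in> borel_measurable lborel"
    using f h unfolding L2_def set_borel_measurable_def
    by (intro borel_measurable_times) (auto intro!: borel_measurable_continuous_on_indicator)
  also have "(\<lambda>t. (indicator {0..l} t *\<^sub>R h t) * (indicator {0..l} t *\<^sub>R f t)) = (\<lambda>t. indicator {0..l} t *\<^sub>R (h t * f t))"
    by (auto simp: indicator_def)
  finally have meas: "set_borel_measurable lborel {0..l} (\<lambda>t. h t * f t)"
    by (simp add: set_borel_measurable_def)
  have "(\<lambda>t. (norm (indicator {0..l} t *\<^sub>R (h t * f t)))\<^sup>2) \<in> borel_measurable lborel"
    using meas unfolding set_borel_measurable_def by measurable
  also have "(\<lambda>t. (norm (indicator {0..l} t *\<^sub>R (h t * f t)))\<^sup>2) = (\<lambda>t. indicator {0..l} t *\<^sub>R (cmod (h t * f t))\<^sup>2)"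
    by (auto simp: indicator_def)
  finally have meas2: "set_borel_measurable lborel {0..l} (\<lambda>t. (cmod (h t * f t))\<^sup>2)"
    by (simp add: set_borel_measurable_def)
  have "set_integrable lborel {0..l} (\<lambda>t. (cmod (h t * f t))\<^sup>2)"
  proof (rule set_integrable_bound[OF _ meas2])
    show "set_integrable lborel {0..l} (\<lambda>t. M\<^sup>2 * (cmod (f t))\<^sup>2)"
      using f unfolding L2_def by (intro set_integrable_mult_right) auto
    have "(cmod (h t))\<^sup>2 * (cmod (f t))\<^sup>2 \<le> M\<^sup>2 * (cmod (f t))\<^sup>2" if "t \<in> {0..l}" for t
      using M[OF that] by (intro mult_right_mono power_mono) auto
    then show "AE t in lborel. t \<in> {0..l} \<longrightarrow> norm ((cmod (h t * f t))\<^sup>2) \<le> norm (M\<^sup>2 * (cmod (f t))\<^sup>2)"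
      by (auto simp: norm_mult power_mult_distrib)
  qed
  with meas show ?thesis by (simp add: L2_def)
qed

lemma L2_continuous:
  assumes "continuous_on {0..l} h"
  shows "L2 l h"
proof -
  have "L2 l (\<lambda>_. 1)"
    unfolding L2_def by (auto intro!: borel_integrable_atLeastAtMost' simp: set_borel_measurable_def)
  from L2_mult_continuous[OF assms this] show ?thesis by simp
qed

lemma L2_add:
  assumes f: "L2 l f" and g: "L2 l g"
  shows "L2 l (\<lambda>t. f t + g t)"
proof -
  have meas: "set_borel_measurable lborel {0..l} (\<lambda>t. f t + g t)"
    using f g unfolding L2_def set_borel_measurable_def by (auto simp: scaleR_add_right)
  have "(\<lambda>t. (norm (indicator {0..l} t *\<^sub>R (f t + g t)))\<^sup>2) \<in> borel_measurable lborel"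
    using meas unfolding set_borel_measurable_def by measurable
  also have "(\<lambda>t. (norm (indicator {0..l} t *\<^sub>R (f t + g t)))\<^sup>2) = (\<lambda>t. indicator {0..l} t *\<^sub>R (cmod (f t + g t))\<^sup>2)"
    by (auto simp: indicator_def)
  finally have meas2: "set_borel_measurable lborel {0..l} (\<lambda>t. (cmod (f t + g t))\<^sup>2)"
    by (simp add: set_borel_measurable_def)
  have "set_integrable lborel {0..l} (\<lambda>t. (cmod (f t + g t))\<^sup>2)"
  proof (rule set_integrable_bound[OF _ meas2])
    show "set_integrable lborel {0..l} (\<lambda>t. 2 * (cmod (f t))\<^sup>2 + 2 * (cmod (g t))\<^sup>2)"
      using f g unfolding L2_def by (intro set_integral_add set_integrable_mult_right) auto
    have "(cmod (x + y))\<^sup>2 \<le> 2 * (cmod x)\<^sup>2 + 2 * (cmod y)\<^sup>2" for x y :: complex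
    proof -
      have "(cmod (x + y))\<^sup>2 \<le> (cmod x + cmod y)\<^sup>2"
        by (intro power_mono norm_triangle_ineq) auto
      also have "\<dots> \<le> 2 * (cmod x)\<^sup>2 + 2 * (cmod y)\<^sup>2"
        using zero_le_power2[of "cmod x - cmod y"] by (simp add: power2_eq_square algebra_simps)
      finally show ?thesis .
    qed
    then show "AE t in lborel. t \<in> {0..l} \<longrightarrow>
        norm ((cmod (f t + g t))\<^sup>2) \<le> norm (2 * (cmod (f t))\<^sup>2 + 2 * (cmod (g t))\<^sup>2)"
      by (auto intro!: AE_I2 order_trans[OF _ abs_ge_self])
  qed
  with meas show ?thesis by (simp add: L2_def)
qed

section \<open>Norm estimates for the resolvent bound\<close>

text \<open>Cauchy-Schwarz against the constant 1, obtained by expanding the nonnegative integral of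
  \<open>(cmod (f t) - c)\<^sup>2\<close> with \<open>c\<close> the mean value of
  \<open>cmod (f t)\<close>.\<close>

lemma L1_norm_le_L2norm:
  assumes "l > 0" "L2 l f"
  shows "set_lebesgue_integral lborel {0..l} (\<lambda>t. cmod (f t)) \<le> sqrt l * L2norm l f"
proof -
  define J where "J = set_lebesgue_integral lborel {0..l} (\<lambda>t. cmod (f t))"
  define S where "S = set_lebesgue_integral lborel {0..l} (\<lambda>t. (cmod (f t))\<^sup>2)"
  have int: "set_integrable lborel {0..l} (\<lambda>t. cmod (f t))" "set_integrable lborel {0..l} (\<lambda>t. (cmod (f t))\<^sup>2)"
    using set_integrable_norm[OF L2_integrable[OF assms(2)]] assms(2) by (auto simp: L2_def)
  have const: "set_integrable lborel {0..l} (\<lambda>t. c)" for c :: real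
    by (intro borel_integrable_atLeastAtMost') auto
  define c where "c = J / l"
  have "0 \<le> set_lebesgue_integral lborel {0..l} (\<lambda>t. (cmod (f t) - c)\<^sup>2)"
    unfolding set_lebesgue_integral_def by (intro integral_nonneg_AE) auto
  also have "(\<lambda>t. (cmod (f t) - c)\<^sup>2) = (\<lambda>t. ((cmod (f t))\<^sup>2 - 2 * c * cmod (f t)) + c\<^sup>2)"
    by (simp add: fun_eq_iff power2_eq_square algebra_simps)
  also have "set_lebesgue_integral lborel {0..l} \<dots> = (S - 2 * c * J) + l * c\<^sup>2"
    using int const assms(1) by (subst set_integral_add | subst set_integral_diff | intro set_integral_diff set_integrable_mult_right)+
      (auto simp: S_def J_def set_integral_const)
  finally have "J\<^sup>2 \<le> l * S"
    using assms(1) by (simp add: c_def field_simps power2_eq_square)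
  then have "J \<le> sqrt (l * S)" by (rule real_le_rsqrt)
  then show ?thesis by (simp add: J_def S_def L2norm_def real_sqrt_mult)
qed

lemma L2norm_le_sup:
  assumes "0 < l" "continuous_on {0..l} y" "\<And>x. x \<in> {0..l} \<Longrightarrow> cmod (y x) \<le> K"
  shows "L2norm l y \<le> sqrt l * K"
proof -
  have "K \<ge> 0" using order_trans[OF norm_ge_zero assms(3)[of 0]] assms(1) by simp
  have "set_lebesgue_integral lborel {0..l} (\<lambda>t. (cmod (y t))\<^sup>2) \<le> set_lebesgue_integral lborel {0..l} (\<lambda>t. K\<^sup>2)"
  proof (rule set_integral_mono)
    show "set_integrable lborel {0..l} (\<lambda>t. (cmod (y t))\<^sup>2)"
      using L2_continuous[OF assms(2)] by (simp add: L2_def)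
    show "set_integrable lborel {0..l} (\<lambda>t. K\<^sup>2)"
      by (intro borel_integrable_atLeastAtMost' continuous_on_const)
  qed (use assms(3) in \<open>auto intro: power_mono\<close>)
  also have "\<dots> = l * K\<^sup>2" using assms(1) by (simp add: set_integral_const)
  finally have "L2norm l y \<le> sqrt (l * K\<^sup>2)" unfolding L2norm_def by (rule real_sqrt_le_mono)
  then show ?thesis using \<open>K \<ge> 0\<close> by (simp add: real_sqrt_mult)
qed

lemma norm_set_integral_mult_le:
  assumes f: "L2 l f" and G: "continuous_on {0..l} G" and pq: "0 \<le> p" "q \<le> l"
    and N: "\<And>t. t \<in> {p..q} \<Longrightarrow> cmod (G t) \<le> N" "N \<ge> 0"
  shows "cmod (set_lebesgue_integral lborel {p..q} (\<lambda>t. G t * f t))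
    \<le> N * set_lebesgue_integral lborel {0..l} (\<lambda>t. cmod (f t))"
proof -
  have sub: "{p..q} \<subseteq> {0..l}" using pq by auto
  have "set_integrable lborel {p..q} (\<lambda>t. G t * f t)"
    by (rule set_integrable_subset[OF L2_integrable[OF L2_mult_continuous[OF G f]]]) (use sub in auto)
  moreover have "set_integrable lborel {0..l} (\<lambda>t. N * cmod (f t))"
    by (intro set_integrable_mult_right set_integrable_norm L2_integrable f)
  ultimately have "cmod (set_lebesgue_integral lborel {p..q} (\<lambda>t. G t * f t))
      \<le> set_lebesgue_integral lborel {0..l} (\<lambda>t. N * cmod (f t))"
    unfolding set_lebesgue_integral_def set_integrable_def
  proof (rule Bochner_Integration.integral_norm_bound_integral)
    fix t
    show "norm (indicator {p..q} t *\<^sub>R (G t * f t)) \<le> indicator {0..l} t *\<^sub>R (N * cmod (f t))"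
      using N sub by (cases "t \<in> {p..q}") (auto simp: indicator_def norm_mult intro: mult_right_mono)
  qed
  then show ?thesis by simp
qed

section \<open>The 3-hyperbolic functions\<close>

definition omega :: complex where "omega = exp (2 * of_real pi * \<i> / 3)"

lemma zeta3_eq: "zeta3 m = omega ^ m"
proof -
  have "2 * complex_of_real pi * \<i> * of_nat m / 3 = of_nat m * (2 * of_real pi * \<i> / 3)" by simp
  then show ?thesis unfolding zeta3_def omega_def by (simp only: exp_of_nat_mult of_real_mult of_real_numeral)
qed

lemma omega_cube: "omega ^ 3 = 1"
proof -
  have "omega ^ 3 = exp (of_nat 3 * (2 * of_real pi * \<i> / 3))"
    unfolding omega_def by (rule exp_of_nat_mult[symmetric])
  also have "of_nat 3 * (2 * of_real pi * \<i> / 3) = 2 * of_real pi * \<i>" by simp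
  finally show ?thesis by (simp only: exp_two_pi_i)
qed

lemma omega_square: "omega ^ 2 = - 1 - omega"
proof -
  \<comment> \<open>A positive imaginary part excludes the root 1, so the factor
    \<open>omega - 1\<close> of the cubic can be cancelled.\<close>
  have "Im omega = sin (2 * pi / 3)"
    by (simp add: omega_def Im_exp)
  moreover have "sin (2 * pi / 3) > 0" by (intro sin_gt_zero) auto
  ultimately have "omega \<noteq> 1" by auto
  moreover have "(omega - 1) * (omega ^ 2 + omega + 1) = 0"
    using omega_cube by (simp add: algebra_simps power3_eq_cube power2_eq_square)
  ultimately have "omega ^ 2 + (omega + 1) = 0" by (simp add: add.assoc)
  then have "omega ^ 2 = - (omega + 1)" by (simp only: eq_neg_iff_add_eq_0)
  then show ?thesis by simp
qed

lemma inverse_omega: "inverse omega = omega ^ 2"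
  using omega_cube by (intro inverse_unique) (simp only: power2_eq_square power3_eq_cube mult.assoc)

lemma omega_inverse_powers:
  "inverse (omega ^ 2) = omega" "inverse ((omega ^ 2) ^ 2) = omega ^ 2"
  by (simp_all only: inverse_omega[symmetric] power_inverse[symmetric] inverse_inverse_eq)

lemma s3_expand:
  "s3 k z = (exp z + inverse (omega ^ k) * exp (z * omega) + inverse ((omega ^ 2) ^ k) * exp (z * omega ^ 2)) / 3"
proof -
  have sum3: "(\<Sum>m<3. g m) = g 0 + g 1 + g 2" for g :: "nat \<Rightarrow> complex"
    by (simp add: eval_nat_numeral)
  show ?thesis
    unfolding s3_def zeta3_eq sum3 power_0 power_one power_one_right inverse_1 mult_1_left mult_1_right
    by simp
qed

lemma s3_0: "s3 0 z = (exp z + exp (z * omega) + exp (z * omega ^ 2)) / 3"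
  and s3_1: "s3 1 z = (exp z + omega ^ 2 * exp (z * omega) + omega * exp (z * omega ^ 2)) / 3"
  and s3_2: "s3 2 z = (exp z + omega * exp (z * omega) + omega ^ 2 * exp (z * omega ^ 2)) / 3"
  unfolding s3_expand power_0 power_one_right inverse_1 mult_1_left inverse_omega omega_inverse_powers
  by (rule refl)+

lemma s3_zero: "s3 0 0 = 1" "s3 1 0 = 0" "s3 2 0 = 0"
  unfolding s3_0 s3_1 s3_2 omega_square by simp_all

text \<open>Differentiation multiplies the m-th exponential by \<open>omega ^ m\<close>, which
  lowers the index by one modulo 3.\<close>

lemma s3_deriv:
  "(s3 0 has_field_derivative s3 2 z) (at z)"
  "(s3 1 has_field_derivative s3 0 z) (at z)"
  "(s3 2 has_field_derivative s3 1 z) (at z)"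
proof -
  have w: "omega ^ 2 * omega = 1" "omega * omega ^ 2 = 1" "omega * omega = omega ^ 2" "omega ^ 2 * omega ^ 2 = omega"
    using omega_cube by (simp_all only: power2_eq_square power3_eq_cube mult.assoc mult_1_right)
  \<comment> \<open>All three functions are brought to one shape with coefficients 1,
    \<open>c\<close>, \<open>d\<close>, so that a single computation covers them.\<close>
  have eq: "s3 0 = (\<lambda>z. (exp z + 1 * exp (z * omega) + 1 * exp (z * omega ^ 2)) / 3)"
    "s3 1 = (\<lambda>z. (exp z + omega ^ 2 * exp (z * omega) + omega * exp (z * omega ^ 2)) / 3)"
    "s3 2 = (\<lambda>z. (exp z + omega * exp (z * omega) + omega ^ 2 * exp (z * omega ^ 2)) / 3)"
    unfolding fun_eq_iff s3_0 s3_1 s3_2 by simp_all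
  have D: "((\<lambda>z. (exp z + c * exp (z * p) + d * exp (z * q)) / 3) has_field_derivative
      (exp z + (c * p) * exp (z * p) + (d * q) * exp (z * q)) / 3) (at z)" for c d p q :: complex
    by (auto intro!: derivative_eq_intros simp: mult_ac)
  show "(s3 0 has_field_derivative s3 2 z) (at z)"
    "(s3 1 has_field_derivative s3 0 z) (at z)"
    "(s3 2 has_field_derivative s3 1 z) (at z)"
    using D[of 1 omega 1 "omega ^ 2"] D[of "omega ^ 2" omega omega "omega ^ 2"] D[of omega omega "omega ^ 2" "omega ^ 2"]
    unfolding eq w mult_1_left .
qed

section \<open>Identities between the 3-hyperbolic functions\<close>

text \<open>Polynomial core of \<open>s3_addition\<close>, with \<open>x0, x1, x2\<close> and
  \<open>y0, y1, y2\<close> standing for the exponentials at two points. The products with equal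
  indices cancel.\<close>

lemma cyclic_minor:
  fixes w :: complex
  assumes "w^2 = -1 - w"
  shows "(x0 + w * x1 + w^2 * x2) * (y0 + w^2 * y1 + w * y2) - (y0 + w * y1 + w^2 * y2) * (x0 + w^2 * x1 + w * x2)
    = (w - w^2) * (x1 * y0 + x2 * y1 + x0 * y2 - x0 * y1 - x1 * y2 - x2 * y0)"
  using assms by algebra

text \<open>Polynomial core of \<open>s3_uminus\<close>. The squares cancel, and by
  \<open>exp_uminus_omega\<close> the surviving products of two exponentials are the exponentials at
  \<open>- z\<close>.\<close>

lemma cyclic_square:
  fixes w :: complex
  assumes "w^2 = -1 - w"
  shows "(x0 + w^2 * x1 + w * x2)^2 - (x0 + x1 + x2) * (x0 + w * x1 + w^2 * x2)
    = 3 * (x1 * x2 + w * (x0 * x2) + w^2 * (x0 * x1))"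
  using assms by algebra

lemma exp_omega_product: "exp z * exp (z * omega) * exp (z * omega ^ 2) = 1"
proof -
  have "z + z * omega + z * omega ^ 2 = z * (1 + omega + omega ^ 2)"
    by (simp only: distrib_left mult_1_right)
  also have "\<dots> = 0" unfolding omega_square by simp
  finally have "exp (z + z * omega + z * omega ^ 2) = 1" by simp
  then show ?thesis by (simp only: exp_add)
qed

text \<open>The three exponentials have product 1 because the cube roots of unity sum to zero, so
  each is inverted by the product of the other two. This makes expressions at \<open>- z\<close>
  polynomial in the exponentials at \<open>z\<close>.\<close>

lemma exp_uminus_omega:
  "exp (- z) = exp (z * omega) * exp (z * omega ^ 2)"
  "exp (- z * omega) = exp z * exp (z * omega ^ 2)"
  "exp (- z * omega ^ 2) = exp z * exp (z * omega)"
proof -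
  have uminus: "exp (- x) = q" if "exp x * q = 1" for x q :: complex
    unfolding exp_minus using that by (rule inverse_unique)
  show "exp (- z) = exp (z * omega) * exp (z * omega ^ 2)"
    by (rule uminus) (simp only: mult.assoc[symmetric] exp_omega_product)
  show "exp (- z * omega) = exp z * exp (z * omega ^ 2)"
    unfolding mult_minus_left
    by (rule uminus) (simp only: mult.assoc[symmetric] mult.commute[of "exp (z * omega)" "exp z"] exp_omega_product)
  show "exp (- z * omega ^ 2) = exp z * exp (z * omega)"
    unfolding mult_minus_left
    by (rule uminus) (simp only: mult.commute[of "exp (z * omega ^ 2)"] exp_omega_product)
qed

text \<open>Up to sign, each side is the determinant of the vectors
  \<open>(s3 0, s3 1, s3 2)\<close> at three points: \<open>v\<close>, \<open>u\<close>, 0 on the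
  left, and the same points shifted by \<open>- u\<close> on the right. The proof checks this
  invariance by reducing both sides to the same cyclic minor. It is what removes
  \<open>y'(l)\<close> from the resolvent formula.\<close>

lemma s3_addition: "s3 2 v * s3 1 u - s3 2 u * s3 1 v = s3 2 (- u) * s3 1 (v - u) - s3 2 (v - u) * s3 1 (- u)"
proof -
  define e0 e1 e2 where e: "e0 = exp u" "e1 = exp (u * omega)" "e2 = exp (u * omega ^ 2)"
  define f0 f1 f2 where f: "f0 = exp v" "f1 = exp (v * omega)" "f2 = exp (v * omega ^ 2)"
  have e1: "e0 * e1 * e2 = 1" unfolding e by (rule exp_omega_product)
  \<comment> \<open>On the right-hand side every monomial contains the product
    \<open>e0 * e1 * e2 = 1\<close>; removing it leaves the monomials of the left-hand side.\<close>
  have red: "f * e0 * e2 * (e1 * e2) = f * e2" "f * e0 * e2 * (e0 * e1) = f * e0"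
    "f * e1 * e2 * (e0 * e2) = f * e2" "f * e1 * e2 * (e0 * e1) = f * e1"
    "f * e0 * e1 * (e0 * e2) = f * e0" "f * e0 * e1 * (e1 * e2) = f * e1" for f
  proof -
    have "f * e0 * e2 * (e1 * e2) = f * e2 * (e0 * e1 * e2)"
      "f * e0 * e2 * (e0 * e1) = f * e0 * (e0 * e1 * e2)"
      "f * e1 * e2 * (e0 * e2) = f * e2 * (e0 * e1 * e2)"
      "f * e1 * e2 * (e0 * e1) = f * e1 * (e0 * e1 * e2)"
      "f * e0 * e1 * (e0 * e2) = f * e0 * (e0 * e1 * e2)"
      "f * e0 * e1 * (e1 * e2) = f * e1 * (e0 * e1 * e2)"
      by (simp_all only: mult_ac)
    then show "f * e0 * e2 * (e1 * e2) = f * e2"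
      "f * e0 * e2 * (e0 * e1) = f * e0"
      "f * e1 * e2 * (e0 * e2) = f * e2"
      "f * e1 * e2 * (e0 * e1) = f * e1"
      "f * e0 * e1 * (e0 * e2) = f * e0"
      "f * e0 * e1 * (e1 * e2) = f * e1"
      unfolding e1 mult_1_right .
  qed
  have diff: "exp ((v - u) * c) = exp (v * c) * exp (- u * c)" for c
  proof -
    have "(v - u) * c = v * c + - u * c" by (simp add: left_diff_distrib)
    then show ?thesis by (simp only: exp_add)
  qed
  have m: "exp (v - u) = f0 * e1 * e2" "exp ((v - u) * omega) = f1 * e0 * e2" "exp ((v - u) * omega ^ 2) = f2 * e0 * e1"
    using diff[of 1] diff[of omega] diff[of "omega ^ 2"]
    unfolding exp_uminus_omega e f mult_1_right mult.assoc .
  have nine: "9 * (a / 3 * (b / 3) - c / 3 * (d / 3)) = a * b - c * d" for a b c d :: complex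
    by (simp add: right_diff_distrib)
  have "9 * (s3 2 v * s3 1 u - s3 2 u * s3 1 v) =
      (omega - omega ^ 2) * (f1 * e0 + f2 * e1 + f0 * e2 - f0 * e1 - f1 * e2 - f2 * e0)"
    unfolding s3_1 s3_2 e[symmetric] f[symmetric] nine by (rule cyclic_minor[OF omega_square])
  moreover have "9 * (s3 2 (v - u) * s3 1 (- u) - s3 2 (- u) * s3 1 (v - u)) =
      (omega - omega ^ 2) * (f1 * e0 * e2 * (e1 * e2) + f2 * e0 * e1 * (e0 * e2) + f0 * e1 * e2 * (e0 * e1)
      - f0 * e1 * e2 * (e0 * e2) - f1 * e0 * e2 * (e0 * e1) - f2 * e0 * e1 * (e1 * e2))"
    unfolding s3_1 s3_2 exp_uminus_omega e[symmetric] m nine by (rule cyclic_minor[OF omega_square])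
  moreover have "\<dots> = - ((omega - omega ^ 2) * (f1 * e0 + f2 * e1 + f0 * e2 - f0 * e1 - f1 * e2 - f2 * e0))"
    unfolding red by (simp add: algebra_simps)
  ultimately have "9 * (s3 2 v * s3 1 u - s3 2 u * s3 1 v) = - (9 * (s3 2 (v - u) * s3 1 (- u) - s3 2 (- u) * s3 1 (v - u)))"
    by (simp only: minus_minus)
  then show ?thesis by (simp only: flip: mult_minus_right) (simp only: mult_cancel_left minus_diff_eq, simp)
qed

lemma s3_uminus: "s3 2 (- z) = s3 1 z ^ 2 - s3 0 z * s3 2 z"
proof -
  have nine: "9 * ((a / 3) ^ 2 - b / 3 * (c / 3)) = a ^ 2 - b * c" "9 * (a / 3) = 3 * a" for a b c :: complex
    by (simp_all add: power_divide right_diff_distrib)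
  have "9 * (s3 1 z ^ 2 - s3 0 z * s3 2 z) = 9 * s3 2 (- z)"
    unfolding s3_0 s3_1 s3_2 exp_uminus_omega nine by (rule cyclic_square[OF omega_square])
  then have "s3 1 z ^ 2 - s3 0 z * s3 2 z = s3 2 (- z)" by (simp only: mult_cancel_left) simp
  then show ?thesis ..
qed

section \<open>The third-order boundary value problem\<close>

text \<open>Variation of constants: \<open>V\<close> is \<open>exp (p * t)\<close> times the
  indefinite integral of \<open>exp (- p * t) * f t\<close>.\<close>

lemma first_order_solution:
  assumes "l > 0" and f: "L2 l f"
  obtains V where "abs_cont_on 0 l V" "V 0 = 0"
    "AE t in lborel. t \<in> {0..l} \<longrightarrow> (V has_vector_derivative (p * V t + f t)) (at t)"
proof -
  define k where "k = (\<lambda>t. exp (- p * of_real t) * f t)"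
  \<comment> \<open>Extension by zero makes the integrand integrable on every interval, as
    \<open>integral_has_vector_derivative_AE\<close> requires.\<close>
  define g where "g = (\<lambda>t. indicator {0..l} t *\<^sub>R k t)"
  have k: "L2 l k"
    unfolding k_def by (intro L2_mult_continuous f continuous_intros)
  have "integrable lborel g"
    using L2_integrable[OF k] by (simp add: g_def set_integrable_def)
  then have g: "g integrable_on {r..s}" for r s
    using integrable_on_lborel integrable_on_subinterval by blast
  have "(\<lambda>t. (cmod (k t))\<^sup>2) integrable_on {0..l}"
    using k by (intro set_borel_integral_eq_integral(1)) (simp add: L2_def)
  then have g2: "(\<lambda>t. (cmod (g t))\<^sup>2) integrable_on {0..l}"
    by (rule integrable_eq) (simp add: g_def)
  define U where "U = (\<lambda>x. integral {0..x} g)"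
  define E where "E = (\<lambda>x::real. exp (p * of_real x))"
  have E: "(E has_vector_derivative p * E t) (at t)" for t
  proof -
    have "((\<lambda>z. exp (p * z)) has_field_derivative p * exp (p * of_real t)) (at (of_real t))"
      by (auto intro!: derivative_eq_intros)
    from has_vector_derivative_real_field[OF this] show ?thesis by (simp add: E_def)
  qed
  have contE: "continuous_on UNIV (\<lambda>x. p * E x)"
    unfolding E_def by (intro continuous_intros)
  show thesis
  proof
    show "abs_cont_on 0 l (\<lambda>x. E x * U x)"
      unfolding U_def by (intro abs_cont_on_mult abs_cont_on_integral g g2 abs_cont_on_C1[OF E contE])
    show "E 0 * U 0 = 0" by (simp add: U_def)
    have "AE t in lborel. 0 < t \<longrightarrow> (U has_vector_derivative g t) (at t)"
      unfolding U_def by (rule integral_has_vector_derivative_AE[OF g])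
    then show "AE t in lborel. t \<in> {0..l} \<longrightarrow>
        ((\<lambda>x. E x * U x) has_vector_derivative (p * (E t * U t) + f t)) (at t)"
      \<comment> \<open>The derivative of \<open>U\<close> is available only to the right of 0, so
        the endpoint 0 joins the exceptional set.\<close>
      using AE_lborel_singleton[of 0]
    proof eventually_elim
      case (elim t)
      show ?case
      proof
        assume t: "t \<in> {0..l}"
        then have U: "(U has_vector_derivative g t) (at t)" using elim by auto
        have "E t * g t = f t"
          using t by (simp add: E_def g_def k_def exp_minus)
        then show "((\<lambda>x. E x * U x) has_vector_derivative (p * (E t * U t) + f t)) (at t)"
          using has_vector_derivative_mult[OF E U] by (simp add: algebra_simps)
      qed
    qed
  qed
qed

text \<open>Partial fractions: with \<open>r\<close> running through the roots \<open>a\<close>,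
  \<open>a * w\<close>, \<open>a * q\<close> of \<open>r ^ 3 = a ^ 3\<close>, the first-order
  solutions are weighted by \<open>- \<i> / (3 * r ^ 2)\<close>. Each differentiation multiplies a
  weight by its root.\<close>

lemma third_order_solution:
  assumes "l > 0" and f: "L2 l f" and a: "a \<noteq> 0"
  obtains y y1 y2 where "abs_cont_on 0 l y" "abs_cont_on 0 l y1" "abs_cont_on 0 l y2" "y 0 = 0" "y1 0 = 0"
    "AE t in lborel. t \<in> {0..l} \<longrightarrow> (y has_vector_derivative y1 t) (at t)"
    "AE t in lborel. t \<in> {0..l} \<longrightarrow> (y1 has_vector_derivative y2 t) (at t)"
    "AE t in lborel. t \<in> {0..l} \<longrightarrow> (y2 has_vector_derivative (a ^ 3 * y t - \<i> * f t)) (at t)"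
proof -
  define w q where "w = omega" "q = omega ^ 2"
  have w: "1 + w + q = 0" "w * q = 1" "w * w = q" "q * q = w"
  proof -
    show "1 + w + q = 0" unfolding w_q_def omega_square by simp
  qed (use omega_cube in \<open>simp_all only: w_q_def power2_eq_square power3_eq_cube mult.assoc mult_1_right\<close>)
  obtain V0 where V0: "abs_cont_on 0 l V0" "V0 0 = 0"
    "AE t in lborel. t \<in> {0..l} \<longrightarrow> (V0 has_vector_derivative (a * V0 t + f t)) (at t)"
    by (rule first_order_solution[OF \<open>l > 0\<close> f])
  obtain V1 where V1: "abs_cont_on 0 l V1" "V1 0 = 0"
    "AE t in lborel. t \<in> {0..l} \<longrightarrow> (V1 has_vector_derivative (a * w * V1 t + f t)) (at t)"
    by (rule first_order_solution[OF \<open>l > 0\<close> f])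
  obtain V2 where V2: "abs_cont_on 0 l V2" "V2 0 = 0"
    "AE t in lborel. t \<in> {0..l} \<longrightarrow> (V2 has_vector_derivative (a * q * V2 t + f t)) (at t)"
    by (rule first_order_solution[OF \<open>l > 0\<close> f])
  define \<kappa> where "\<kappa> = - \<i> / (3 * a ^ 2)"
  have \<kappa>: "3 * a ^ 2 * \<kappa> = - \<i>" using a by (simp add: \<kappa>_def)
  have D: "AE t in lborel. t \<in> {0..l} \<longrightarrow> ((\<lambda>x. c * (V0 x + r * V1 x + s * V2 x)) has_vector_derivative
      c * (a * V0 t + f t + r * (a * w * V1 t + f t) + s * (a * q * V2 t + f t))) (at t)" for c r s
    using V0(3) V1(3) V2(3)
  proof eventually_elim
    case (elim t)
    then show ?case
      by (intro impI has_vector_derivative_mult_right has_vector_derivative_add) auto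
  qed
  have AC: "abs_cont_on 0 l (\<lambda>x. c * (V0 x + r * V1 x + s * V2 x))" for c r s
    using V0(1) V1(1) V2(1) by (intro abs_cont_on_cmult abs_cont_on_add)
  show thesis
  proof
    show "abs_cont_on 0 l (\<lambda>x. \<kappa> * (V0 x + w * V1 x + q * V2 x))"
      "abs_cont_on 0 l (\<lambda>x. a * \<kappa> * (V0 x + q * V1 x + w * V2 x))"
      "abs_cont_on 0 l (\<lambda>x. a ^ 2 * \<kappa> * (V0 x + 1 * V1 x + 1 * V2 x))"
      by (rule AC)+
    show "\<kappa> * (V0 0 + w * V1 0 + q * V2 0) = 0" "a * \<kappa> * (V0 0 + q * V1 0 + w * V2 0) = 0"
      by (simp_all add: V0(2) V1(2) V2(2))
    \<comment> \<open>The forcing term \<open>g\<close> drops out because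
      \<open>1 + w + q = 0\<close>; the same happens at the next derivative.\<close>
    have "\<kappa> * (a * v0 + g + w * (a * w * v1 + g) + q * (a * q * v2 + g)) = a * \<kappa> * (v0 + q * v1 + w * v2)" for v0 v1 v2 g
      using w by algebra
    then show "AE t in lborel. t \<in> {0..l} \<longrightarrow> ((\<lambda>x. \<kappa> * (V0 x + w * V1 x + q * V2 x)) has_vector_derivative
        a * \<kappa> * (V0 t + q * V1 t + w * V2 t)) (at t)"
      using D[of \<kappa> w q] by (simp only:)
    have "a * \<kappa> * (a * v0 + g + q * (a * w * v1 + g) + w * (a * q * v2 + g)) = a ^ 2 * \<kappa> * (v0 + 1 * v1 + 1 * v2)" for v0 v1 v2 g
      using w by algebra
    then show "AE t in lborel. t \<in> {0..l} \<longrightarrow> ((\<lambda>x. a * \<kappa> * (V0 x + q * V1 x + w * V2 x)) has_vector_derivative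
        a ^ 2 * \<kappa> * (V0 t + 1 * V1 t + 1 * V2 t)) (at t)"
      using D[of "a * \<kappa>" q w] by (simp only:)
    \<comment> \<open>At the third derivative all weights are equal, so the forcing terms add up to
      \<open>3 * a ^ 2 * \<kappa> * g = - \<i> * g\<close>.\<close>
    have "a ^ 2 * \<kappa> * (a * v0 + g + 1 * (a * w * v1 + g) + 1 * (a * q * v2 + g)) =
        a ^ 3 * (\<kappa> * (v0 + w * v1 + q * v2)) - \<i> * g" for v0 v1 v2 g
      using \<kappa> by algebra
    then show "AE t in lborel. t \<in> {0..l} \<longrightarrow> ((\<lambda>x. a ^ 2 * \<kappa> * (V0 x + 1 * V1 x + 1 * V2 x)) has_vector_derivative
        (a ^ 3 * (\<kappa> * (V0 t + w * V1 t + q * V2 t)) - \<i> * f t)) (at t)"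
      using D[of "a ^ 2 * \<kappa>" 1 1] by (simp only:)
  qed
qed

section \<open>Integration against the kernel and the representation formula\<close>

lemma s3_has_vector_derivative:
  "((\<lambda>t. s3 0 (a * of_real (c - t))) has_vector_derivative - a * s3 2 (a * of_real (c - t))) (at t)"
  "((\<lambda>t. s3 1 (a * of_real (c - t))) has_vector_derivative - a * s3 0 (a * of_real (c - t))) (at t)"
  "((\<lambda>t. s3 2 (a * of_real (c - t))) has_vector_derivative - a * s3 1 (a * of_real (c - t))) (at t)"
proof -
  have *: "((\<lambda>t. s3 i (a * of_real (c - t))) has_vector_derivative - a * s3 j (a * of_real (c - t))) (at t)"
    if "\<And>z. (s3 i has_field_derivative s3 j z) (at z)" for i j
  proof -
    have "((\<lambda>z. s3 i (a * (of_real c - z))) has_field_derivative s3 j (a * (of_real c - of_real t)) * (- a)) (at (of_real t))"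
      by (rule DERIV_chain2[OF that]) (auto intro!: derivative_eq_intros)
    from has_vector_derivative_real_field[OF this] show ?thesis by (simp add: mult.commute)
  qed
  show "((\<lambda>t. s3 0 (a * of_real (c - t))) has_vector_derivative - a * s3 2 (a * of_real (c - t))) (at t)"
    "((\<lambda>t. s3 1 (a * of_real (c - t))) has_vector_derivative - a * s3 0 (a * of_real (c - t))) (at t)"
    "((\<lambda>t. s3 2 (a * of_real (c - t))) has_vector_derivative - a * s3 1 (a * of_real (c - t))) (at t)"
    by (rule *, rule s3_deriv)+
qed

lemma continuous_on_s3: "continuous_on A (s3 k)"
proof -
  have "continuous_on A (\<lambda>z. s3 k z)"
    unfolding s3_expand by (intro continuous_intros) simp
  then show ?thesis by simp
qed

lemma continuous_on_s3_kernel: "continuous_on A (\<lambda>t. s3 k (a * of_real (c - t)))"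
  by (rule continuous_on_compose2[OF continuous_on_s3[of UNIV k]]) (intro continuous_intros, simp)

lemma abs_cont_on_s3_kernel:
  "abs_cont_on p q (\<lambda>t. s3 0 (a * of_real (c - t)))"
  "abs_cont_on p q (\<lambda>t. s3 1 (a * of_real (c - t)))"
  "abs_cont_on p q (\<lambda>t. s3 2 (a * of_real (c - t)))"
  by (rule abs_cont_on_C1, rule s3_has_vector_derivative, rule continuous_on_mult_left, rule continuous_on_s3_kernel)+

lemma L2_s3_kernel: "L2 l f \<Longrightarrow> L2 l (\<lambda>t. s3 2 (a * of_real (c - t)) * f t)"
  by (rule L2_mult_continuous[OF continuous_on_s3_kernel])

text \<open>Lagrange's identity: if \<open>y''' = a\<^sup>3 y - \<i> f\<close>, the \<open>t\<close>-derivative of this expression is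
  \<open>- \<i> s\<^sub>2(a(c - t)) f(t)\<close>, because \<open>s\<^sub>2(a(c - t))\<close> solves the homogeneous adjoint equation.\<close>

definition concomitant :: "complex \<Rightarrow> (real \<Rightarrow> complex) \<Rightarrow> (real \<Rightarrow> complex) \<Rightarrow> (real \<Rightarrow> complex) \<Rightarrow> real \<Rightarrow> real \<Rightarrow> complex" where
  "concomitant a y y1 y2 c t = s3 2 (a * of_real (c - t)) * y2 t + a * s3 1 (a * of_real (c - t)) * y1 t
     + a ^ 2 * s3 0 (a * of_real (c - t)) * y t"

text \<open>Integrating Lagrange's identity expresses the integral by boundary values alone. The
  point \<open>c\<close> stays free, since the resolvent formula uses it at \<open>x\<close>, 0 and
  \<open>l\<close>.\<close>

lemma integral_s3_kernel:
  assumes f: "L2 l f"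
    and AC: "abs_cont_on 0 l y" "abs_cont_on 0 l y1" "abs_cont_on 0 l y2"
    and d: "AE t in lborel. t \<in> {0..l} \<longrightarrow> (y has_vector_derivative y1 t) (at t)"
    and d1: "AE t in lborel. t \<in> {0..l} \<longrightarrow> (y1 has_vector_derivative y2 t) (at t)"
    and d2: "AE t in lborel. t \<in> {0..l} \<longrightarrow> (y2 has_vector_derivative (a ^ 3 * y t - \<i> * f t)) (at t)"
    and pq: "0 \<le> p" "p \<le> q" "q \<le> l"
  shows "set_lebesgue_integral lborel {p..q} (\<lambda>t. s3 2 (a * of_real (c - t)) * f t) =
    \<i> * (concomitant a y y1 y2 c q - concomitant a y y1 y2 c p)"
proof -
  let ?B = "concomitant a y y1 y2 c" and ?k = "\<lambda>k t. s3 k (a * of_real (c - t))"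
  have B: "?B = (\<lambda>t. ?k 2 t * y2 t + a * (?k 1 t * y1 t) + a ^ 2 * (?k 0 t * y t))"
    unfolding concomitant_def mult.assoc ..
  have "abs_cont_on 0 l ?B"
    unfolding B by (intro abs_cont_on_add abs_cont_on_cmult abs_cont_on_mult abs_cont_on_s3_kernel AC)
  then have ACB: "abs_cont_on p q ?B"
    by (rule abs_cont_on_subinterval[OF _ pq(1,3)])
  have ae: "AE t in lborel. t \<in> {p..q} \<longrightarrow> (?B has_vector_derivative - \<i> * (?k 2 t * f t)) (at t)"
    using d d1 d2
  proof eventually_elim
    case (elim t)
    show ?case
    proof
      assume "t \<in> {p..q}"
      then have t: "t \<in> {0..l}" using pq by auto
      then have dt: "(y has_vector_derivative y1 t) (at t)" "(y1 has_vector_derivative y2 t) (at t)"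
          "(y2 has_vector_derivative (a ^ 3 * y t - \<i> * f t)) (at t)"
        using elim by auto
      note K = s3_has_vector_derivative[of a c t]
      have "(?B has_vector_derivative
          (?k 2 t * (a ^ 3 * y t - \<i> * f t) + (- a * ?k 1 t) * y2 t)
          + a * (?k 1 t * y2 t + (- a * ?k 0 t) * y1 t)
          + a ^ 2 * (?k 0 t * y1 t + (- a * ?k 2 t) * y t)) (at t)"
        unfolding B
        by (rule has_vector_derivative_add[OF has_vector_derivative_add[OF
              has_vector_derivative_mult[OF K(3) dt(3)]
              has_vector_derivative_mult_right[OF has_vector_derivative_mult[OF K(2) dt(2)]]]
              has_vector_derivative_mult_right[OF has_vector_derivative_mult[OF K(1) dt(1)]]])
      moreover have "(k2 * (a ^ 3 * u - \<i> * g) + (- a * k1) * u2) + a * (k1 * u2 + (- a * k0) * u1)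
          + a ^ 2 * (k0 * u1 + (- a * k2) * u) = - \<i> * (k2 * g)" for k0 k1 k2 u u1 u2 g
        by (simp add: algebra_simps power2_eq_square power3_eq_cube)
      ultimately show "(?B has_vector_derivative - \<i> * (?k 2 t * f t)) (at t)"
        by (simp only:)
    qed
  qed
  have i_cancel: "\<i> * (- \<i> * z) = z" for z by simp
  from abs_cont_on_has_integral[OF pq(2) ACB ae]
  have "((\<lambda>t. \<i> * (- \<i> * (?k 2 t * f t))) has_integral \<i> * (?B q - ?B p)) {p..q}"
    by (rule has_integral_mult_right)
  then have "((\<lambda>t. ?k 2 t * f t) has_integral \<i> * (?B q - ?B p)) {p..q}"
    unfolding i_cancel .
  then have *: "integral {p..q} (\<lambda>t. ?k 2 t * f t) = \<i> * (?B q - ?B p)"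
    by (rule integral_unique)
  \<comment> \<open>Absolute integrability identifies the gauge integral computed above with the
    Lebesgue integral.\<close>
  have "set_integrable lborel {p..q} (\<lambda>t. ?k 2 t * f t)"
    by (rule set_integrable_subset[OF L2_integrable[OF L2_s3_kernel[OF f]]]) (use pq in auto)
  from set_borel_integral_eq_integral(2)[OF this] * show ?thesis by simp
qed

lemma Lres_representation:
  assumes "0 < l" "lam \<noteq> 0" "Delta l \<theta> lam \<noteq> 0" and f: "L2 l f"
    and sol: "Lres_eq l \<theta> (lam^3) y w f" and x: "x \<in> {0..l}"
  shows "y x =
         \<i> / (lam^4 * Delta l \<theta> lam) *
         ( set_lebesgue_integral lborel {0..x}
             (\<lambda>t. s3 2 (\<i> * lam * of_real (x - t)) * s3 2 (\<i> * lam * of_real l) * f t)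
         - \<theta> * set_lebesgue_integral lborel {x..l}
             (\<lambda>t. s3 2 (\<i> * lam * of_real (x - t)) * s3 2 (- \<i> * lam * of_real l) * f t)
         + set_lebesgue_integral lborel {0..l}
             (\<lambda>t. (\<theta> * s3 2 (\<i> * lam * of_real (x - l)) * s3 2 (- \<i> * lam * of_real t)
                   - s3 2 (\<i> * lam * of_real x) * s3 2 (\<i> * lam * of_real (l - t))) * f t))"
proof -
  define a where "a = \<i> * lam"
  define k where "k = (\<lambda>c t. s3 2 (a * of_real (c - t)))"
  obtain y1 y2 where AC: "abs_cont_on 0 l y" "abs_cont_on 0 l y1" "abs_cont_on 0 l y2"
    and d: "AE t in lborel. t \<in> {0..l} \<longrightarrow> (y has_vector_derivative y1 t) (at t)"
      "AE t in lborel. t \<in> {0..l} \<longrightarrow> (y1 has_vector_derivative y2 t) (at t)"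
      "AE t in lborel. t \<in> {0..l} \<longrightarrow> (y2 has_vector_derivative w t) (at t)"
    and bc: "y 0 = 0" "y1 0 = \<theta> * y1 l" "y l = 0"
    and eq: "AE t in lborel. t \<in> {0..l} \<longrightarrow> \<i> * w t - lam^3 * y t = f t"
    using sol unfolding Lres_eq_def Ldom_def by (elim conjE exE) (rule that)
  have d2: "AE t in lborel. t \<in> {0..l} \<longrightarrow> (y2 has_vector_derivative (a ^ 3 * y t - \<i> * f t)) (at t)"
    using d(3) eq
  proof eventually_elim
    case (elim t)
    \<comment> \<open>Solves the equation for the third derivative, using
      \<open>a ^ 3 = - \<i> * lam ^ 3\<close>.\<close>
    have "w t = a ^ 3 * y t - \<i> * f t" if "f t = \<i> * w t - lam^3 * y t"
      unfolding that a_def by (simp add: power3_eq_cube algebra_simps)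
    then show ?case using elim by auto
  qed
  define B where "B = concomitant a y y1 y2"
  have int: "set_lebesgue_integral lborel {p..q} (\<lambda>t. k c t * f t) = \<i> * (B c q - B c p)"
    if "0 \<le> p" "p \<le> q" "q \<le> l" for p q c
    unfolding k_def B_def by (rule integral_s3_kernel[OF f AC d(1,2) d2 that])
  have kf: "set_integrable lborel {0..l} (\<lambda>t. k c t * f t)" for c
    unfolding k_def by (rule L2_integrable[OF L2_s3_kernel[OF f]])
  define u v where "u = a * of_real l" and "v = a * of_real x"
  define S S' where "S = s3 2 u" and "S' = s3 2 (- u)"
  define z where "z = y1 l"
  \<comment> \<open>\<open>P\<close>, \<open>P'\<close> and \<open>z\<close> are the boundary values
    that the boundary conditions leave undetermined; all three have to drop out in the end.\<close>
  define P P' where "P = y2 0" and "P' = y2 l"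
  have vu: "a * of_real (x - l) = v - u" "a * of_real (0 - l) = - u" "a * of_real (l - 0) = u" "a * of_real (x - 0) = v"
    by (simp_all add: u_def v_def algebra_simps)
  have I1: "set_lebesgue_integral lborel {0..x} (\<lambda>t. k x t * S * f t) = S * (\<i> * (a ^ 2 * y x - (s3 2 v * P + a * s3 1 v * (\<theta> * z))))"
  proof -
    have "(\<lambda>t. k x t * S * f t) = (\<lambda>t. S * (k x t * f t))" by (simp add: mult_ac)
    \<comment> \<open>At \<open>t = x\<close> the kernel argument is 0, where only
      \<open>s3 0\<close> survives; this is how the value \<open>y x\<close> enters.\<close>
    moreover have "B x x = a ^ 2 * y x" "B x 0 = s3 2 v * P + a * s3 1 v * (\<theta> * z)"
      unfolding B_def concomitant_def vu bc z_def P_def by (simp_all add: s3_zero s3_zero[unfolded One_nat_def])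
    ultimately show ?thesis
      using int[of 0 x x] x by simp
  qed
  have I2: "set_lebesgue_integral lborel {x..l} (\<lambda>t. k x t * S' * f t) =
      S' * (\<i> * ((s3 2 (v - u) * P' + a * s3 1 (v - u) * z) - a ^ 2 * y x))"
  proof -
    have "(\<lambda>t. k x t * S' * f t) = (\<lambda>t. S' * (k x t * f t))" by (simp add: mult_ac)
    moreover have "B x x = a ^ 2 * y x" "B x l = s3 2 (v - u) * P' + a * s3 1 (v - u) * z"
      unfolding B_def concomitant_def vu bc z_def P'_def by (simp_all add: s3_zero s3_zero[unfolded One_nat_def])
    ultimately show ?thesis
      using int[of x l x] x by simp
  qed
  have I3: "set_lebesgue_integral lborel {0..l} (\<lambda>t. (\<theta> * s3 2 (v - u) * k 0 t - s3 2 v * k l t) * f t) =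
      \<theta> * s3 2 (v - u) * (\<i> * (s3 2 (- u) * P' + a * s3 1 (- u) * z)) +
      s3 2 v * (\<i> * (s3 2 u * P + a * s3 1 u * (\<theta> * z)))"
  proof -
    have "(\<lambda>t. (\<theta> * s3 2 (v - u) * k 0 t - s3 2 v * k l t) * f t) =
        (\<lambda>t. \<theta> * s3 2 (v - u) * (k 0 t * f t) - s3 2 v * (k l t * f t))"
      by (simp add: left_diff_distrib mult.assoc)
    then have "set_lebesgue_integral lborel {0..l} (\<lambda>t. (\<theta> * s3 2 (v - u) * k 0 t - s3 2 v * k l t) * f t) =
        set_lebesgue_integral lborel {0..l} (\<lambda>t. \<theta> * s3 2 (v - u) * (k 0 t * f t)) -
        set_lebesgue_integral lborel {0..l} (\<lambda>t. s3 2 v * (k l t * f t))"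
      using kf by (simp only: set_integral_diff set_integrable_mult_right)
    also have "\<dots> = \<theta> * s3 2 (v - u) * (\<i> * (B 0 l - B 0 0)) - s3 2 v * (\<i> * (B l l - B l 0))"
      using int[of 0 l 0] int[of 0 l l] \<open>0 < l\<close> by (simp only: set_integral_mult_right order_refl less_imp_le)
    finally have *: "set_lebesgue_integral lborel {0..l} (\<lambda>t. (\<theta> * s3 2 (v - u) * k 0 t - s3 2 v * k l t) * f t) =
        \<theta> * s3 2 (v - u) * (\<i> * (B 0 l - B 0 0)) - s3 2 v * (\<i> * (B l l - B l 0))" .
    have "B 0 l = s3 2 (- u) * P' + a * s3 1 (- u) * z" "B 0 0 = 0" "B l l = 0"
        "B l 0 = s3 2 u * P + a * s3 1 u * (\<theta> * z)"
      unfolding B_def concomitant_def vu bc z_def P_def P'_def by (simp_all add: s3_zero s3_zero[unfolded One_nat_def])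
    then show ?thesis unfolding * by (simp only: diff_0_right diff_0 mult_minus_right diff_minus_eq_add)
  qed
  have D: "lam ^ 4 * Delta l \<theta> lam = lam ^ 2 * (S + \<theta> * S')"
    using \<open>lam \<noteq> 0\<close> by (simp add: Delta_def S_def S'_def u_def a_def power4_eq_xxxx power2_eq_square)
  have nz: "lam ^ 2 * (S + \<theta> * S') \<noteq> 0"
    using assms(2,3) unfolding D[symmetric] by simp
  \<comment> \<open>The terms in \<open>P\<close> and \<open>P'\<close> cancel outright, while the
    coefficient of \<open>z\<close> is the difference of the two sides of
    \<open>s3_addition\<close>. The special values are abstracted to variables, so that only ring
    laws are at work.\<close>
  have ring: "\<sigma> * (\<i> * (b * Y - (v2 * P + a * v1 * (\<theta> * z))))
      - \<theta> * (\<tau> * (\<i> * ((w2 * P' + a * w1 * z) - b * Y)))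
      + (\<theta> * w2 * (\<i> * (\<tau> * P' + a * m1 * z)) + v2 * (\<i> * (\<sigma> * P + a * u1 * (\<theta> * z)))) =
      \<i> * b * (\<sigma> + \<theta> * \<tau>) * Y + \<i> * a * \<theta> * z * ((v2 * u1 - \<sigma> * v1) - (\<tau> * w1 - w2 * m1))"
    for \<sigma> \<tau> b Y v1 v2 w1 w2 u1 m1
    by (simp add: algebra_simps)
  have "S * (\<i> * (a ^ 2 * y x - (s3 2 v * P + a * s3 1 v * (\<theta> * z))))
      - \<theta> * (S' * (\<i> * ((s3 2 (v - u) * P' + a * s3 1 (v - u) * z) - a ^ 2 * y x)))
      + (\<theta> * s3 2 (v - u) * (\<i> * (s3 2 (- u) * P' + a * s3 1 (- u) * z)) +
      s3 2 v * (\<i> * (s3 2 u * P + a * s3 1 u * (\<theta> * z)))) =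
      \<i> * a ^ 2 * (S + \<theta> * S') * y x + \<i> * a * \<theta> * z *
        ((s3 2 v * s3 1 u - s3 2 u * s3 1 v) - (s3 2 (- u) * s3 1 (v - u) - s3 2 (v - u) * s3 1 (- u)))"
    unfolding S_def S'_def by (rule ring)
  also have "\<dots> = \<i> * a ^ 2 * (S + \<theta> * S') * y x"
    unfolding s3_addition[of v u] by simp
  also have "\<dots> = - \<i> * (lam ^ 2 * (S + \<theta> * S')) * y x"
    unfolding a_def by (simp add: power_mult_distrib mult_ac)
  finally have "y x = \<i> / (lam ^ 4 * Delta l \<theta> lam) *
      (set_lebesgue_integral lborel {0..x} (\<lambda>t. k x t * S * f t)
       - \<theta> * set_lebesgue_integral lborel {x..l} (\<lambda>t. k x t * S' * f t)
       + set_lebesgue_integral lborel {0..l} (\<lambda>t. (\<theta> * s3 2 (v - u) * k 0 t - s3 2 v * k l t) * f t))"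
    unfolding I1 I2 I3 D using nz by (simp add: mult.assoc)
  then show ?thesis
    unfolding k_def S_def S'_def u_def v_def a_def
    by (simp add: right_diff_distrib)
qed

section \<open>Solvability and boundedness\<close>

text \<open>Cramer's rule for the coefficients of the homogeneous solutions
  \<open>s3 1 (a * t)\<close> and \<open>s3 2 (a * t)\<close>. The first equation encodes the
  condition \<open>y(l) = 0\<close>, the second the quasi-periodicity of \<open>y'\<close> after
  division by \<open>a\<close>.\<close>

lemma boundary_system:
  fixes p r \<theta> S0 S1 S2 :: complex
  assumes "S2 + \<theta> * (S1 ^ 2 - S0 * S2) \<noteq> 0"
  obtains A C where "p + (A * S1 + C * S2) = 0" "A = \<theta> * (r + (A * S0 + C * S1))"
proof -
  define D where "D = S2 + \<theta> * (S1 ^ 2 - S0 * S2)"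
  have D0: "D \<noteq> 0" using assms by (simp add: D_def)
  define A where "A = (\<theta> * r * S2 - \<theta> * p * S1) / D"
  define C where "C = - (\<theta> * r * S1 + p * (1 - \<theta> * S0)) / D"
  have D: "A * D = \<theta> * r * S2 - \<theta> * p * S1" "C * D = - (\<theta> * r * S1 + p * (1 - \<theta> * S0))"
    using D0 by (simp_all add: A_def C_def)
  have "(p + (A * S1 + C * S2)) * D = p * D + (A * D) * S1 + (C * D) * S2"
    by (simp add: algebra_simps)
  also have "\<dots> = 0"
    unfolding D by (simp add: D_def algebra_simps power2_eq_square)
  finally have 1: "p + (A * S1 + C * S2) = 0" using D0 by simp
  have "(A - \<theta> * (r + (A * S0 + C * S1))) * D = A * D - \<theta> * (r * D + (A * D) * S0 + (C * D) * S1)"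
    by (simp add: algebra_simps)
  also have "\<dots> = 0"
    unfolding D by (simp add: D_def algebra_simps power2_eq_square)
  finally have 2: "A = \<theta> * (r + (A * S0 + C * S1))" using D0 by simp
  show thesis by (rule that[OF 1 2])
qed

lemma Lres_solvable:
  assumes "0 < l" "lam \<noteq> 0" "Delta l \<theta> lam \<noteq> 0" and f: "L2 l f"
  shows "\<exists>y w. Lres_eq l \<theta> (lam^3) y w f"
proof -
  define a where "a = \<i> * lam"
  have a: "a \<noteq> 0" using assms(2) by (simp add: a_def)
  obtain y y1 y2 where AC: "abs_cont_on 0 l y" "abs_cont_on 0 l y1" "abs_cont_on 0 l y2"
    and y0: "y 0 = 0" "y1 0 = 0"
    and d: "AE t in lborel. t \<in> {0..l} \<longrightarrow> (y has_vector_derivative y1 t) (at t)"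
      "AE t in lborel. t \<in> {0..l} \<longrightarrow> (y1 has_vector_derivative y2 t) (at t)"
      "AE t in lborel. t \<in> {0..l} \<longrightarrow> (y2 has_vector_derivative (a ^ 3 * y t - \<i> * f t)) (at t)"
    by (rule third_order_solution[OF assms(1) f a])
  \<comment> \<open>This is \<open>s3 k (a * t)\<close>, written as a kernel with parameter
    \<open>- a\<close> and \<open>c = 0\<close> so that the kernel lemmas apply.\<close>
  define h where "h = (\<lambda>k t. s3 k (- a * of_real (0 - t)))"
  have h: "(h 0 has_vector_derivative a * h 2 t) (at t)" "(h 1 has_vector_derivative a * h 0 t) (at t)"
    "(h 2 has_vector_derivative a * h 1 t) (at t)" for t
    using s3_has_vector_derivative[of "- a" 0 t] unfolding h_def minus_minus .
  have ACh: "abs_cont_on 0 l (h 0)" "abs_cont_on 0 l (h 1)" "abs_cont_on 0 l (h 2)"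
    unfolding h_def by (rule abs_cont_on_s3_kernel)+
  have h0: "h 0 0 = 1" "h 1 0 = 0" "h 2 0 = 0"
    by (simp_all add: h_def s3_zero s3_zero[unfolded One_nat_def])
  have "h 2 l + \<theta> * (h 1 l ^ 2 - h 0 l * h 2 l) = lam ^ 2 * Delta l \<theta> lam"
    unfolding h_def s3_uminus[symmetric] using assms(2) by (simp add: Delta_def a_def)
  then have "h 2 l + \<theta> * (h 1 l ^ 2 - h 0 l * h 2 l) \<noteq> 0" using assms(2,3) by simp
  then obtain A C where A: "y l + (A * h 1 l + C * h 2 l) = 0" "A = \<theta> * (y1 l / a + (A * h 0 l + C * h 1 l))"
    by (rule boundary_system)
  \<comment> \<open>The homogeneous solution \<open>h 0\<close> is left out because it equals 1 at
    0, so the condition at 0 is preserved for any \<open>A\<close> and \<open>C\<close>.\<close>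
  define Y where "Y = (\<lambda>t. y t + (A * h 1 t + C * h 2 t))"
  define Y1 where "Y1 = (\<lambda>t. y1 t + (A * (a * h 0 t) + C * (a * h 1 t)))"
  define Y2 where "Y2 = (\<lambda>t. y2 t + (A * (a * (a * h 2 t)) + C * (a * (a * h 0 t))))"
  \<comment> \<open>The third derivative is prescribed by the differential equation, so the
    resolvent equation holds at every \<open>t\<close> and square integrability follows from
    continuity of \<open>Y\<close>.\<close>
  define w where "w = (\<lambda>t. a ^ 3 * Y t + - \<i> * f t)"
  have ACY: "abs_cont_on 0 l Y" "abs_cont_on 0 l Y1" "abs_cont_on 0 l Y2"
    unfolding Y_def Y1_def Y2_def by (intro abs_cont_on_add abs_cont_on_cmult AC ACh)+
  note hv = has_vector_derivative_mult_right[OF h(1), of a] has_vector_derivative_mult_right[OF h(2), of a]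
    has_vector_derivative_mult_right[OF h(3), of a]
  have dY: "AE t in lborel. t \<in> {0..l} \<longrightarrow> (Y has_vector_derivative Y1 t) (at t)"
    using d(1)
  proof eventually_elim
    case (elim t)
    show ?case unfolding Y_def Y1_def
      by (rule impI, rule has_vector_derivative_add[OF mp[OF elim]
            has_vector_derivative_add[OF has_vector_derivative_mult_right[OF h(2)] has_vector_derivative_mult_right[OF h(3)]]])
  qed
  have dY1: "AE t in lborel. t \<in> {0..l} \<longrightarrow> (Y1 has_vector_derivative Y2 t) (at t)"
    using d(2)
  proof eventually_elim
    case (elim t)
    show ?case unfolding Y1_def Y2_def
      by (rule impI, rule has_vector_derivative_add[OF mp[OF elim]
            has_vector_derivative_add[OF has_vector_derivative_mult_right[OF hv(1)] has_vector_derivative_mult_right[OF hv(2)]]])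
  qed
  have dY2: "AE t in lborel. t \<in> {0..l} \<longrightarrow> (Y2 has_vector_derivative w t) (at t)"
    using d(3)
  proof eventually_elim
    case (elim t)
    have w: "w t = a ^ 3 * y t - \<i> * f t + (A * (a * (a * (a * h 1 t))) + C * (a * (a * (a * h 2 t))))"
      by (simp add: w_def Y_def algebra_simps power3_eq_cube)
    show ?case unfolding Y2_def w
      by (rule impI, rule has_vector_derivative_add[OF mp[OF elim]
            has_vector_derivative_add[OF has_vector_derivative_mult_right[OF has_vector_derivative_mult_right[OF hv(3)]]
              has_vector_derivative_mult_right[OF has_vector_derivative_mult_right[OF hv(1)]]]])
  qed
  have "L2 l w"
    unfolding w_def by (intro L2_add L2_mult_continuous[OF _ f] L2_continuous continuous_on_const
        continuous_on_mult_left abs_cont_on_imp_continuous_on ACY)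
  moreover have "Y 0 = 0" "Y l = 0" using A(1) by (simp_all only: Y_def y0 h0) simp_all
  moreover have "Y1 0 = \<theta> * Y1 l"
  proof -
    have "Y1 0 = a * A" unfolding Y1_def y0 h0 by simp
    also have "\<dots> = a * (\<theta> * (y1 l / a + (A * h 0 l + C * h 1 l)))" by (subst A(2)) (rule refl)
    also have "\<dots> = \<theta> * Y1 l" unfolding Y1_def using a by (simp add: distrib_left mult_ac)
    finally show ?thesis .
  qed
  ultimately have "Ldom l \<theta> Y w"
    unfolding Ldom_def using ACY dY dY1 dY2 by blast
  moreover have "\<i> * w t - lam ^ 3 * Y t = f t" for t
    by (simp add: w_def a_def power_mult_distrib power3_eq_cube algebra_simps)
  ultimately show ?thesis unfolding Lres_eq_def by auto
qed

text \<open>The representation bounds \<open>y\<close> uniformly by the L1 norm of \<open>f\<close>.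
  Passing from the supremum to the L2 norm, and from the L1 to the L2 norm of \<open>f\<close>,
  costs a factor \<open>sqrt l\<close> each.\<close>

lemma Lres_bounded:
  assumes "0 < l" "cmod \<theta> = 1" "lam \<noteq> 0" "Delta l \<theta> lam \<noteq> 0"
  shows "\<exists>C. \<forall>f y w. L2 l f \<and> Lres_eq l \<theta> (lam^3) y w f \<longrightarrow> L2norm l y \<le> C * L2norm l f"
proof -
  \<comment> \<open>All arguments of \<open>s3 2\<close> in the formula lie in the closed disc of
    this radius.\<close>
  define R where "R = cmod lam * l"
  have "bounded (s3 2 ` cball 0 R)"
    by (intro compact_imp_bounded compact_continuous_image continuous_on_s3) auto
  then obtain M where M: "\<And>z. cmod z \<le> R \<Longrightarrow> cmod (s3 2 z) \<le> M"
    unfolding bounded_iff by (metis imageI mem_cball_0)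
  have "R \<ge> 0" using assms(1) by (simp add: R_def)
  then have "M \<ge> 0" using order_trans[OF norm_ge_zero M[of 0]] by simp
  have arg: "cmod (s3 2 (\<i> * lam * of_real r)) \<le> M" "cmod (s3 2 (- \<i> * lam * of_real r)) \<le> M" if "\<bar>r\<bar> \<le> l" for r :: real
    using that by (auto intro!: M mult_left_mono simp: R_def norm_mult)
  have cont: "continuous_on {0..l} (\<lambda>t. s3 2 (\<i> * lam * of_real (c - t)))" for c
    by (rule continuous_on_s3_kernel)
  have cont': "continuous_on {0..l} (\<lambda>t. s3 2 (- \<i> * lam * of_real t))"
    using cont[of 0] by simp
  define \<kappa> where "\<kappa> = \<i> / (lam^4 * Delta l \<theta> lam)"
  have MM: "cmod (z1 * z2) \<le> M\<^sup>2" if "cmod z1 \<le> M" "cmod z2 \<le> M" for z1 z2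
    using that \<open>M \<ge> 0\<close> unfolding norm_mult power2_eq_square by (intro mult_mono) auto
  have "L2norm l y \<le> (l * (cmod \<kappa> * (4 * M\<^sup>2))) * L2norm l f" if f: "L2 l f" and sol: "Lres_eq l \<theta> (lam^3) y w f" for f y w
  proof -
    define J where "J = set_lebesgue_integral lborel {0..l} (\<lambda>t. cmod (f t))"
    \<comment> \<open>The factor 4 counts the kernel products, each at most
      \<open>M\<^sup>2\<close>: one in each of the first two integrals and two in the third. Factors
      \<open>\<theta>\<close> have modulus 1.\<close>
    have "cmod (y x) \<le> cmod \<kappa> * (4 * M\<^sup>2 * J)" if x: "x \<in> {0..l}" for x
    proof -
      let ?I1 = "set_lebesgue_integral lborel {0..x}
             (\<lambda>t. s3 2 (\<i> * lam * of_real (x - t)) * s3 2 (\<i> * lam * of_real l) * f t)"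
      let ?I2 = "set_lebesgue_integral lborel {x..l}
             (\<lambda>t. s3 2 (\<i> * lam * of_real (x - t)) * s3 2 (- \<i> * lam * of_real l) * f t)"
      let ?I3 = "set_lebesgue_integral lborel {0..l}
             (\<lambda>t. (\<theta> * s3 2 (\<i> * lam * of_real (x - l)) * s3 2 (- \<i> * lam * of_real t)
                   - s3 2 (\<i> * lam * of_real x) * s3 2 (\<i> * lam * of_real (l - t))) * f t)"
      have y: "y x = \<kappa> * (?I1 - \<theta> * ?I2 + ?I3)"
        unfolding \<kappa>_def by (rule Lres_representation[OF assms(1,3,4) f sol x])
      have 1: "cmod ?I1 \<le> M\<^sup>2 * J"
        unfolding J_def using x \<open>0 < l\<close>
        by (intro norm_set_integral_mult_le f continuous_on_mult_right cont MM arg) auto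
      have 2: "cmod ?I2 \<le> M\<^sup>2 * J"
        unfolding J_def using x \<open>0 < l\<close>
        by (intro norm_set_integral_mult_le f continuous_on_mult_right cont MM arg) auto
      have 3: "cmod ?I3 \<le> (2 * M\<^sup>2) * J"
        unfolding J_def
      proof (intro norm_set_integral_mult_le f)
        show "continuous_on {0..l} (\<lambda>t. \<theta> * s3 2 (\<i> * lam * of_real (x - l)) * s3 2 (- \<i> * lam * of_real t)
            - s3 2 (\<i> * lam * of_real x) * s3 2 (\<i> * lam * of_real (l - t)))"
          by (intro continuous_on_diff continuous_on_mult_left cont cont')
        fix t assume t: "t \<in> {0..l}"
        have "cmod (\<theta> * s3 2 (\<i> * lam * of_real (x - l)) * s3 2 (- \<i> * lam * of_real t)) \<le> M\<^sup>2"
          unfolding mult.assoc[of \<theta>] norm_mult[of \<theta>] assms(2) mult_1_left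
          using x t by (intro MM arg) auto
        moreover have "cmod (s3 2 (\<i> * lam * of_real x) * s3 2 (\<i> * lam * of_real (l - t))) \<le> M\<^sup>2"
          using x t by (intro MM arg) auto
        ultimately show "cmod (\<theta> * s3 2 (\<i> * lam * of_real (x - l)) * s3 2 (- \<i> * lam * of_real t)
            - s3 2 (\<i> * lam * of_real x) * s3 2 (\<i> * lam * of_real (l - t))) \<le> 2 * M\<^sup>2"
          by (intro order_trans[OF norm_triangle_ineq4]) linarith
      qed auto
      have "cmod (?I1 - \<theta> * ?I2 + ?I3) \<le> cmod (?I1 - \<theta> * ?I2) + cmod ?I3" by (rule norm_triangle_ineq)
      also have "cmod (?I1 - \<theta> * ?I2) \<le> cmod ?I1 + cmod (\<theta> * ?I2)" by (rule norm_triangle_ineq4)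
      also have "cmod (\<theta> * ?I2) = cmod ?I2" unfolding norm_mult assms(2) by (rule mult_1_left)
      finally have "cmod (?I1 - \<theta> * ?I2 + ?I3) \<le> 4 * M\<^sup>2 * J" using 1 2 3 by linarith
      then show ?thesis unfolding y norm_mult[of \<kappa>] by (rule mult_left_mono) simp
    qed
    moreover have "continuous_on {0..l} y"
      using sol unfolding Lres_eq_def Ldom_def by (blast intro: abs_cont_on_imp_continuous_on)
    ultimately have "L2norm l y \<le> sqrt l * (cmod \<kappa> * (4 * M\<^sup>2 * J))"
      using L2norm_le_sup \<open>0 < l\<close> by blast
    also have "\<dots> \<le> sqrt l * (cmod \<kappa> * (4 * M\<^sup>2 * (sqrt l * L2norm l f)))"
      unfolding J_def using assms(1) by (intro mult_left_mono L1_norm_le_L2norm f) auto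
    also have "\<dots> = (sqrt l * sqrt l) * (cmod \<kappa> * (4 * M\<^sup>2)) * L2norm l f" by (simp only: mult_ac)
    finally show ?thesis using assms(1) by simp
  qed
  then show ?thesis by blast
qed

theorem theorem9p1:
  fixes l :: real and \<theta> lam :: complex
  assumes "0 < l" and "cmod \<theta> = 1" and "\<theta> \<noteq> -1"
    and "lam \<noteq> 0" and "Delta l \<theta> lam \<noteq> 0"
  shows "lam^3 \<in> resolvent_set l \<theta> \<and>
    (\<forall>f y w. L2 l f \<and> Lres_eq l \<theta> (lam^3) y w f \<longrightarrow>
      (\<forall>x\<in>{0..l}. y x =
         \<i> / (lam^4 * Delta l \<theta> lam) *
         ( set_lebesgue_integral lborel {0..x}
             (\<lambda>t. s3 2 (\<i> * lam * of_real (x - t)) * s3 2 (\<i> * lam * of_real l) * f t)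
         - \<theta> * set_lebesgue_integral lborel {x..l}
             (\<lambda>t. s3 2 (\<i> * lam * of_real (x - t)) * s3 2 (- \<i> * lam * of_real l) * f t)
         + set_lebesgue_integral lborel {0..l}
             (\<lambda>t. (\<theta> * s3 2 (\<i> * lam * of_real (x - l)) * s3 2 (- \<i> * lam * of_real t)
                   - s3 2 (\<i> * lam * of_real x) * s3 2 (\<i> * lam * of_real (l - t))) * f t))))"
proof (intro conjI allI impI ballI)
  show "lam^3 \<in> resolvent_set l \<theta>"
    unfolding resolvent_set_def
  proof (intro CollectI conjI allI impI)
    fix f assume "L2 l f"
    then show "\<exists>y w. Lres_eq l \<theta> (lam^3) y w f"
      using Lres_solvable assms by blast
  next
    fix y w assume sol: "Lres_eq l \<theta> (lam^3) y w (\<lambda>_. 0)"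
    \<comment> \<open>For the zero right-hand side every integral in the representation vanishes,
      which gives uniqueness.\<close>
    have "L2 l (\<lambda>_. 0)" by (intro L2_continuous continuous_on_const)
    then have "y x = 0" if "x \<in> {0..l}" for x
      using Lres_representation[OF assms(1,4,5) _ sol that] by simp
    then show "AE t in lborel. t \<in> {0..l} \<longrightarrow> y t = 0" by simp
  next
    show "\<exists>C. \<forall>f y w. L2 l f \<and> Lres_eq l \<theta> (lam^3) y w f \<longrightarrow> L2norm l y \<le> C * L2norm l f"
      by (rule Lres_bounded[OF assms(1,2,4,5)])
  qed
qed (elim conjE, rule Lres_representation[OF assms(1,4,5)])

end
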